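(* Let $d\ge3$ be an odd integer. A tournament $G$ on $2d$ vertices with adjacency matrix $A$ and Seidel matrix $S=\sqrt{-1}(A-A^T)$ is the tournament of some complex spherical $2$-code $X\subset\Omega(d)$ (with $|X|=2d$) if and only if one of the following holds: (i) $G$ is obtained from a doubly regular tournament by deleting one vertex; (ii) $S^2$ is permutationally similar to $\begin{pmatrix}kI+lJ&0\\0&kI+lJ\end{pmatrix}$ (blocks of size $d$) for some positive integers $k,l$.
   Context: $\Omega(d)=\{x\in\mathbb C^d:x^*x=1\}$. For finite $X\subset\Omega(d)$, $A(X)=\{x^*y:x,y\in X,x\ne y\}$; $X$ is a complex spherical $2$-code if $|A(X)|=2$ and $A(X)$ contains a non-real number, so $A(X)=\{\alpha,\overline\alpha\}$ with $\mathrm{Im}\,\alpha>0$. Its tournament is $(X,E)$ with $E=\{(x,y):x^*y=\alpha\}$, whose adjacency matrix has $A_{xy}=1$ if $(x,y)\in E$ and $0$ otherwise. A tournament is doubly regular if every vertex has the same out-degree and every pair of distinct vertices has the same number of common out-neighbours. $I$, $J$ are the identity and all-ones matrices; $M$ and $N$ are permutationally similar if $N=PMP^T$ for a permutation matrix $P$. *)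

theory Defs
  imports Complex_Main "Jordan_Normal_Form.Matrix" "HOL-Combinatorics.Permutations"
begin

definition cinner :: "complex vec \<Rightarrow> complex vec \<Rightarrow> complex" where
  "cinner x y = conjugate x \<bullet> y"

definition Omega :: "nat \<Rightarrow> complex vec set" where
  "Omega d = {x. x \<in> carrier_vec d \<and> cinner x x = 1}"

definition angle_set :: "complex vec set \<Rightarrow> complex set" where
  "angle_set X = {cinner x y | x y. x \<in> X \<and> y \<in> X \<and> x \<noteq> y}"

definition complex_2code :: "nat \<Rightarrow> complex vec set \<Rightarrow> bool" where
  "complex_2code d X \<longleftrightarrow> finite X \<and> X \<subseteq> Omega d \<and> card (angle_set X) = 2
     \<and> (\<exists>a\<in>angle_set X. a \<notin> \<real>)"

definition code_alpha :: "complex vec set \<Rightarrow> complex" where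
  "code_alpha X = (THE a. a \<in> angle_set X \<and> Im a > 0)"

definition code_tournament :: "complex vec set \<Rightarrow> complex vec \<Rightarrow> complex vec \<Rightarrow> bool" where
  "code_tournament X x y \<longleftrightarrow> x \<in> X \<and> y \<in> X \<and> x \<noteq> y \<and> cinner x y = code_alpha X"

definition tournament :: "'a set \<Rightarrow> ('a \<Rightarrow> 'a \<Rightarrow> bool) \<Rightarrow> bool" where
  "tournament V E \<longleftrightarrow> finite V \<and> (\<forall>x y. E x y \<longrightarrow> x \<in> V \<and> y \<in> V)
     \<and> (\<forall>x\<in>V. \<not> E x x)
     \<and> (\<forall>x\<in>V. \<forall>y\<in>V. x \<noteq> y \<longrightarrow> (E x y \<or> E y x) \<and> \<not> (E x y \<and> E y x))"

definition doubly_regular :: "'a set \<Rightarrow> ('a \<Rightarrow> 'a \<Rightarrow> bool) \<Rightarrow> bool" where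
  "doubly_regular V E \<longleftrightarrow> tournament V E
     \<and> (\<exists>k. \<forall>x\<in>V. card {y\<in>V. E x y} = k)
     \<and> (\<exists>m. \<forall>x\<in>V. \<forall>y\<in>V. x \<noteq> y \<longrightarrow> card {z\<in>V. E x z \<and> E y z} = m)"

definition tournament_iso :: "'a set \<Rightarrow> ('a \<Rightarrow> 'a \<Rightarrow> bool) \<Rightarrow> 'b set \<Rightarrow> ('b \<Rightarrow> 'b \<Rightarrow> bool) \<Rightarrow> bool" where
  "tournament_iso V E W F \<longleftrightarrow> (\<exists>f. bij_betw f V W \<and> (\<forall>x\<in>V. \<forall>y\<in>V. E x y \<longleftrightarrow> F (f x) (f y)))"

definition delete_vertex :: "'a set \<Rightarrow> ('a \<Rightarrow> 'a \<Rightarrow> bool) \<Rightarrow> 'a \<Rightarrow> 'a \<Rightarrow> 'a \<Rightarrow> bool" where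
  "delete_vertex V E v x y \<longleftrightarrow> E x y \<and> x \<in> V - {v} \<and> y \<in> V - {v}"

definition adj_mat :: "nat \<Rightarrow> (nat \<Rightarrow> nat \<Rightarrow> bool) \<Rightarrow> complex mat" where
  "adj_mat n E = mat n n (\<lambda>(i, j). if E i j then 1 else 0)"

definition seidel_mat :: "nat \<Rightarrow> (nat \<Rightarrow> nat \<Rightarrow> bool) \<Rightarrow> complex mat" where
  "seidel_mat n E = \<i> \<cdot>\<^sub>m (adj_mat n E - transpose_mat (adj_mat n E))"

definition all_ones_mat :: "nat \<Rightarrow> complex mat" where
  "all_ones_mat n = mat n n (\<lambda>_. 1)"

definition permutation_mat :: "nat \<Rightarrow> complex mat \<Rightarrow> bool" where
  "permutation_mat n P \<longleftrightarrow>
     (\<exists>\<sigma>. \<sigma> permutes {..<n} \<and> P = mat n n (\<lambda>(i, j). if \<sigma> i = j then 1 else 0))"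

definition perm_similar :: "nat \<Rightarrow> complex mat \<Rightarrow> complex mat \<Rightarrow> bool" where
  "perm_similar n M N \<longleftrightarrow> (\<exists>P. permutation_mat n P \<and> N = P * M * transpose_mat P)"

end

theory Submission
  imports Defs "Jordan_Normal_Form.Determinant"
begin

text \<open>Write T = A - A^T, S = iT, n = 2d and z = T1. A code with angles a + ib and a - ib has Gram matrix
  (1 - a)I + aJ + bS of rank at most d. The kernel of this matrix inside the orthogonal complement of 1
  consists of eigenvectors of S for the eigenvalue -c, where c = (1 - a)/b; they are orthogonal
  to their conjugates, to 1 and to z. By dimension count these vectors span the whole space, which gives
  T T^T = c^2 I + (q/n - c^2)(J/n + z z^T/q) with q = |z|^2. Its constant diagonal forces z to
  be a multiple of a sign vector, so T T^T = S^2 is kI plus l times the indicator of equal signs.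
  A congruence mod 4 on three rows excludes l = 0 and leaves only l = -2 among the negative values,
  and then z is itself a sign vector with which T can be bordered to a doubly regular tournament.
  Conversely, such a block form determines the spectrum of S, and the Gram vectors can be
  written down from an orthonormal family of eigenvectors.\<close>

subsection \<open>Orthonormal families\<close>

text \<open>The two alternatives of the theorem are one condition split by the sign of l: T T^T = kI
  + l * (indicator of equal signs) with balanced signs, where l > 0 is the matrix alternative and l
  = -2 the deleted vertex. The dimension count closes exactly: rank at most d and orthogonality to 1
  leave at least d - 1 eigenvectors, conjugation doubles them because T is real, and 1 and z supply
  the two missing dimensions. Two degenerations have to be ruled out for this. z is nonzero because
  n is even, which makes every row sum of T odd; and c is positive, since for c = 0 the eigenvectors
  would not be separated from their conjugates. The value -2 arises as follows: k + l = 2d - 1 is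
  the diagonal of T T^T, and k + ld is its eigenvalue on 1, hence equal to q/n and nonnegative. This
  bounds l from below, and l = 2 mod 4 selects -2; then k + ld = 1, which is why T1 is a sign vector
  in that case.\<close>

text \<open>Padding fewer than n equations with zero rows gives a square matrix with a vanishing
  last row; its transpose kills the last unit vector, so the determinant is 0. Existence of
  eigenvectors is always drawn from this count of equations.\<close>

lemma homogeneous_system_nontrivial:
  fixes L :: "(nat \<Rightarrow> complex) list"
  assumes "length L < n"
  shows "\<exists>w. (\<exists>i<n. w i \<noteq> 0) \<and> (\<forall>a\<in>set L. (\<Sum>i<n. a i * w i) = 0)"
proof -
  define A where "A = mat n n (\<lambda>(k, i). if k < length L then (L ! k) i else 0)"
  have A: "A \<in> carrier_mat n n" by (simp add: A_def)
  have last: "n - 1 < n" "\<not> n - 1 < length L" using assms by auto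
  have "A\<^sup>T *\<^sub>v unit_vec n (n - 1) = 0\<^sub>v n"
    using last by (intro eq_vecI) (auto simp: A_def)
  moreover have "unit_vec n (n - 1) \<noteq> (0\<^sub>v n :: complex vec)"
    using last by (metis index_unit_vec(1) index_zero_vec(1) one_neq_zero)
  ultimately have "det A\<^sup>T = 0"
    using det_0_iff_vec_prod_zero_field[of "A\<^sup>T" n] A unit_vec_carrier[of n "n - 1"]
    by (metis transpose_carrier_mat)
  then have "det A = 0" using det_transpose[OF A] by simp
  then obtain v where v: "v \<in> carrier_vec n" "v \<noteq> 0\<^sub>v n" "A *\<^sub>v v = 0\<^sub>v n"
    using det_0_iff_vec_prod_zero_field[OF A] by auto
  have "\<exists>i<n. v $ i \<noteq> 0"
    using v(1,2) by (metis carrier_vecD eq_vecI index_zero_vec)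
  moreover have "(\<Sum>i<n. a i * v $ i) = 0" if "a \<in> set L" for a
  proof -
    obtain k where k: "k < length L" "a = L ! k" using \<open>a \<in> set L\<close> by (metis in_set_conv_nth)
    have "0 = (A *\<^sub>v v) $ k" using v(3) k(1) assms by simp
    also have "\<dots> = (\<Sum>i<n. a i * v $ i)"
      using k assms v(1) by (auto simp: A_def scalar_prod_def atLeast0LessThan intro!: sum.cong)
    finally show ?thesis by simp
  qed
  ultimately show ?thesis by blast
qed

definition orthonormal :: "nat \<Rightarrow> nat \<Rightarrow> (nat \<Rightarrow> nat \<Rightarrow> complex) \<Rightarrow> bool" where
  "orthonormal n m v \<longleftrightarrow>
     (\<forall>a<m. \<forall>b<m. (\<Sum>i<n. cnj (v a i) * v b i) = (if a = b then 1 else 0))"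

lemma orthonormalD:
  "orthonormal n m v \<Longrightarrow> a < m \<Longrightarrow> b < m \<Longrightarrow> (\<Sum>i<n. cnj (v a i) * v b i) = (if a = b then 1 else 0)"
  by (simp add: orthonormal_def)

text \<open>Gram-Schmidt without the projection step: the extension hypothesis already supplies a
  vector orthogonal to the earlier ones, so only normalisation remains, and \<open>K\<close> need
  only be closed under scaling.\<close>

lemma orthonormal_greedy:
  assumes scale: "\<And>w s. K w \<Longrightarrow> K (\<lambda>i. s * w i)"
    and extend: "\<And>m v. m < r \<Longrightarrow> orthonormal n m v \<Longrightarrow> (\<forall>a<m. K (v a)) \<Longrightarrow>
      \<exists>w. K w \<and> (\<exists>i<n. w i \<noteq> 0) \<and> (\<forall>a<m. (\<Sum>i<n. cnj (v a i) * w i) = 0)"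
  shows "\<exists>v. orthonormal n r v \<and> (\<forall>a<r. K (v a))"
proof -
  have "m \<le> r \<Longrightarrow> \<exists>v. orthonormal n m v \<and> (\<forall>a<m. K (v a))" for m
  proof (induction m)
    case 0
    show ?case by (simp add: orthonormal_def)
  next
    case (Suc m)
    then obtain v where v: "orthonormal n m v" "\<forall>a<m. K (v a)" by auto
    from Suc.prems have "m < r" by simp
    from extend[OF this v] obtain w i0 where w: "K w" "i0 < n" "w i0 \<noteq> 0"
      "\<forall>a<m. (\<Sum>i<n. cnj (v a i) * w i) = 0" by auto
    define q where "q = (\<Sum>i<n. (cmod (w i))\<^sup>2)"
    have "q > 0" unfolding q_def using w(2,3) by (intro sum_pos2[of _ i0]) auto
    have sq: "(\<Sum>i<n. cnj (w i) * w i) = of_real q"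
      unfolding q_def of_real_sum
      by (intro sum.cong refl, subst complex_norm_square) (rule mult.commute)
    define s where "s = complex_of_real (1 / sqrt q)"
    have s: "cnj s = s" "s * s * of_real q = 1"
      using \<open>q > 0\<close> by (simp_all add: s_def flip: of_real_mult)
    define u where "u = v(m := (\<lambda>i. s * w i))"
    have "orthonormal n (Suc m) u"
      unfolding orthonormal_def
    proof (intro allI impI)
      fix a b assume "a < Suc m" "b < Suc m"
      have 1: "(\<Sum>i<n. cnj (s * w i) * (s * w i)) = 1"
      proof -
        have "(\<Sum>i<n. cnj (s * w i) * (s * w i)) = (\<Sum>i<n. s * s * (cnj (w i) * w i))"
          by (intro sum.cong refl) (simp add: s(1))
        then show ?thesis unfolding sum_distrib_left[symmetric] sq by (simp add: s(2))
      qed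
      have 2: "(\<Sum>i<n. cnj (v a i) * (s * w i)) = 0" if "a < m" for a
        using w(4) that unfolding mult.left_commute[of _ s] sum_distrib_left[symmetric] by simp
      have "(\<Sum>i<n. cnj (s * w i) * v b i) = cnj (\<Sum>i<n. cnj (v b i) * (s * w i))" for b
        unfolding cnj_sum by (intro sum.cong) simp_all
      then have 3: "(\<Sum>i<n. cnj (s * w i) * v b i) = 0" if "b < m" for b
        using 2[OF that] by (metis complex_cnj_zero)
      show "(\<Sum>i<n. cnj (u a i) * u b i) = (if a = b then 1 else 0)"
        using \<open>a < Suc m\<close> \<open>b < Suc m\<close> 1 2[of a] 3[of b] orthonormalD[OF v(1), of a b]
        by (auto simp: u_def less_Suc_eq)
    qed
    moreover have "\<forall>a<Suc m. K (u a)"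
      using v(2) scale[OF w(1)] by (auto simp: u_def less_Suc_eq)
    ultimately show ?case by blast
  qed
  then show ?thesis by simp
qed

text \<open>Orthonormality says that B, with the vectors as columns, has its conjugate transpose A
  as a left inverse. For square matrices A is then also a right inverse, which is the resolution of
  the identity.\<close>

lemma orthonormal_basis_complete:
  assumes "orthonormal n n e" "i < n" "j < n"
  shows "(\<Sum>a<n. e a i * cnj (e a j)) = (if i = j then 1 else 0)"
proof -
  define A where "A = mat n n (\<lambda>(a, i). cnj (e a i))"
  define B where "B = mat n n (\<lambda>(i, a). e a i)"
  have [simp]: "A \<in> carrier_mat n n" "B \<in> carrier_mat n n" by (auto simp: A_def B_def)
  have "(A * B) $$ (a, b) = (\<Sum>i<n. cnj (e a i) * e b i)" if "a < n" "b < n" for a b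
    using that by (simp add: A_def B_def scalar_prod_def atLeast0LessThan)
  then have "A * B = 1\<^sub>m n"
    using orthonormalD[OF assms(1)] by (intro eq_matI) (simp_all add: A_def B_def)
  then have "B * A = 1\<^sub>m n" by (rule mat_mult_left_right_inverse[rotated 2]) simp_all
  then have "(B * A) $$ (i, j) = (if i = j then 1 else 0)" using assms by simp
  then show ?thesis
    using assms by (auto simp: A_def B_def scalar_prod_def atLeast0LessThan)
qed

text \<open>Moves a skew matrix across the bilinear pairing, at the cost of a sign. No conjugation
  is involved, so the rule serves integer row sums and complex eigenvectors alike.\<close>

lemma skew_sum_swap:
  fixes T :: "nat \<Rightarrow> nat \<Rightarrow> 'a :: comm_ring_1"
  assumes "\<And>i j. i < n \<Longrightarrow> j < n \<Longrightarrow> T i j = - T j i"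
  shows "(\<Sum>i<n. a i * (\<Sum>j<n. T i j * b j)) = - (\<Sum>j<n. (\<Sum>i<n. T j i * a i) * b j)"
proof -
  have "(\<Sum>i<n. a i * (\<Sum>j<n. T i j * b j)) = (\<Sum>i<n. \<Sum>j<n. a i * (T i j * b j))"
    by (simp add: sum_distrib_left)
  also have "\<dots> = (\<Sum>j<n. \<Sum>i<n. a i * (T i j * b j))" by (rule sum.swap)
  also have "\<dots> = (\<Sum>j<n. \<Sum>i<n. - (T j i * a i * b j))"
    by (intro sum.cong refl, subst assms) (simp_all add: mult_ac)
  finally show ?thesis by (simp add: sum_distrib_right sum_negf)
qed

section \<open>Resolution of the identity by conjugate eigenvectors\<close>

text \<open>The m eigenvectors for i c, their m conjugates for -i c, and the normalised vectors 1
  and z are 2m + 2 = n orthonormal vectors, hence a basis.\<close>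

lemma completeness_conjugate_pairs:
  fixes T :: "nat \<Rightarrow> nat \<Rightarrow> complex" and z :: "nat \<Rightarrow> complex" and c q :: real
  assumes n: "n = 2 * m + 2"
    and skew: "\<And>i j. i < n \<Longrightarrow> j < n \<Longrightarrow> T i j = - T j i"
    and "c \<noteq> 0"
    and on: "orthonormal n m v"
    and eig: "\<And>a i. a < m \<Longrightarrow> i < n \<Longrightarrow> (\<Sum>j<n. T i j * v a j) = \<i> * c * v a i"
    and v1: "\<And>a. a < m \<Longrightarrow> (\<Sum>i<n. v a i) = 0"
    and vz: "\<And>a. a < m \<Longrightarrow> (\<Sum>i<n. z i * v a i) = 0"
    and zr: "\<And>i. cnj (z i) = z i"
    and z1: "(\<Sum>i<n. z i) = 0"
    and q: "(\<Sum>i<n. z i * z i) = of_real q" "q > 0"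
    and ij: "i < n" "j < n"
  shows "(\<Sum>a<m. v a i * cnj (v a j)) + (\<Sum>a<m. cnj (v a i) * v a j)
           + 1 / of_nat n + z i * z j / of_real q = (if i = j then 1 else 0)"
proof -
  have "n > 0" using n by simp
  define s where "s = complex_of_real (1 / sqrt (real n))"
  define t where "t = complex_of_real (1 / sqrt q)"
  have s: "cnj s = s" "s * s = 1 / of_nat n" 
    unfolding s_def by (simp_all flip: of_real_mult)
  have t: "cnj t = t" "t * t = 1 / of_real q"
    using q(2) unfolding t_def by (simp_all flip: of_real_mult)
  have tq: "t * (t * of_real q) = 1" using t(2) q(2) by (simp flip: mult.assoc)
  have sn: "s * (s * of_nat n) = 1" using s(2) \<open>n > 0\<close> by (simp flip: mult.assoc)
  \<comment> \<open>Without a conjugate this is orthogonality of \<open>v b\<close> to the conjugate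
    of \<open>v a\<close>. Both vectors have eigenvalue i c and T is skew, so the sum times i c
    equals its own negative.\<close>
  have vv: "(\<Sum>i<n. v a i * v b i) = 0" if "a < m" "b < m" for a b
  proof -
    have "(\<Sum>i<n. v b i * (\<Sum>j<n. T i j * v a j)) = - (\<Sum>j<n. (\<Sum>i<n. T j i * v b i) * v a j)"
      by (rule skew_sum_swap) (rule skew)
    then have "(\<Sum>i<n. v b i * (\<i> * c * v a i)) = - (\<Sum>j<n. (\<i> * c * v b j) * v a j)"
      using eig that by simp
    moreover have "(\<Sum>i<n. v b i * (\<i> * c * v a i)) = \<i> * c * (\<Sum>i<n. v a i * v b i)"
      "(\<Sum>j<n. (\<i> * c * v b j) * v a j) = \<i> * c * (\<Sum>i<n. v a i * v b i)"
      by (auto simp: sum_distrib_left mult_ac)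
    ultimately have "\<i> * c * (\<Sum>i<n. v a i * v b i) = - (\<i> * c * (\<Sum>i<n. v a i * v b i))"
      by (simp only:)
    then show ?thesis using \<open>c \<noteq> 0\<close> by (simp add: eq_neg_iff_add_eq_0)
  qed
  have vv': "(\<Sum>i<n. cnj (v a i) * cnj (v b i)) = 0" if "a < m" "b < m" for a b
    using arg_cong[OF vv[OF that], of cnj] by simp
  have on': "(\<Sum>i<n. v a i * cnj (v b i)) = (if a = b then 1 else 0)" if "a < m" "b < m" for a b
    using arg_cong[OF orthonormalD[OF on that], of cnj] by simp
  have v1': "(\<Sum>i<n. cnj (v a i)) = 0" if "a < m" for a
    using arg_cong[OF v1[OF that], of cnj] by simp
  have vz': "(\<Sum>i<n. z i * cnj (v a i)) = 0" if "a < m" for a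
    using arg_cong[OF vz[OF that], of cnj] zr by simp
  define e where "e a i = (if a < m then v a i else if a < 2 * m then cnj (v (a - m) i)
     else if a = 2 * m then s else t * z i)" for a i
  have cases: "a < m \<or> (\<exists>a'<m. a = m + a') \<or> a = 2 * m \<or> a = 2 * m + 1" if "a < n" for a
    using that n by presburger
  have e1: "e a = v a" if "a < m" for a using that by (auto simp: e_def)
  have e2: "e (m + a) = (\<lambda>i. cnj (v a i))" if "a < m" for a using that by (auto simp: e_def)
  have e3: "e (2 * m) = (\<lambda>_. s)" "e (2 * m + 1) = (\<lambda>i. t * z i)" by (auto simp: e_def)
  have pull: "(\<Sum>i<n. f i * (x * g i)) = x * (\<Sum>i<n. f i * g i)"
    "(\<Sum>i<n. (x * f i) * g i) = x * (\<Sum>i<n. f i * g i)"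
    "(\<Sum>i<n. f i * x) = x * (\<Sum>i<n. f i)"
    "(\<Sum>i<n. x * f i) = x * (\<Sum>i<n. f i)" for f g and x :: complex
    by (simp_all add: sum_distrib_left mult_ac)
  have comm: "(\<Sum>i<n. v a i * z i) = (\<Sum>i<n. z i * v a i)"
    "(\<Sum>i<n. cnj (v a i) * z i) = (\<Sum>i<n. z i * cnj (v a i))" for a
    by (simp_all add: mult_ac)
  have "orthonormal n n e"
    unfolding orthonormal_def
  proof (intro allI impI)
    fix a b assume "a < n" "b < n"
    show "(\<Sum>i<n. cnj (e a i) * e b i) = (if a = b then 1 else 0)"
      using cases[OF \<open>a < n\<close>] cases[OF \<open>b < n\<close>]
      apply (elim disjE exE conjE)
      apply (simp_all add: e1 e2 e3 orthonormalD[OF on] on' vv vv')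
      apply (simp_all add: e3[simplified] pull comm v1 v1' vz vz' z1 zr s t q)
      using s t q \<open>n > 0\<close> zr tq sn
      apply (simp_all add: mult_ac)
      done
  qed
  from orthonormal_basis_complete[OF this ij]
  have "(\<Sum>a<n. e a i * cnj (e a j)) = (if i = j then 1 else 0)" .
  also have "(\<Sum>a<n. e a i * cnj (e a j)) =
     (\<Sum>a<m + m. e a i * cnj (e a j)) + s * s + (t * t) * (z i * z j)"
    unfolding n using e3 by (simp add: s(1) t(1) zr mult.assoc mult.left_commute flip: mult_2)
  also have "(\<Sum>a<m + m. e a i * cnj (e a j)) =
     (\<Sum>a<m. v a i * cnj (v a j)) + (\<Sum>a<m. cnj (v a i) * v a j)"
    using e1 e2 sum.atLeastLessThan_concat[of 0 m "m + m" "\<lambda>a. e a i * cnj (e a j)", symmetric]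
      sum.shift_bounds_nat_ivl[of "\<lambda>a. e a i * cnj (e a j)" 0 m m]
    by (simp add: atLeast0LessThan add.commute)
  finally show ?thesis by (simp add: s(2) t(2))
qed

subsection \<open>Sign matrices of tournaments\<close>

text \<open>The entry of T = A - A^T, kept in \<open>int\<close> so that parity and divisibility
  arguments apply directly.\<close>

definition tsgn :: "('a \<Rightarrow> 'a \<Rightarrow> bool) \<Rightarrow> 'a \<Rightarrow> 'a \<Rightarrow> int" where
  "tsgn E x y = (if E x y then 1 else if E y x then - 1 else 0)"

lemma tournament_finite: "tournament V E \<Longrightarrow> finite V"
  unfolding tournament_def by blast

lemma tsgn_self:
  assumes "tournament V E" "x \<in> V"
  shows "tsgn E x x = 0"
proof -
  have "\<not> E x x" using assms unfolding tournament_def by blast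
  then show ?thesis by (simp add: tsgn_def)
qed

lemma tournament_edge:
  assumes "tournament V E" "x \<in> V" "y \<in> V" "x \<noteq> y"
  shows "E y x \<longleftrightarrow> \<not> E x y"
  using assms unfolding tournament_def by blast

lemma tsgn_cases:
  "tournament V E \<Longrightarrow> x \<in> V \<Longrightarrow> y \<in> V \<Longrightarrow> x \<noteq> y \<Longrightarrow> tsgn E x y = 1 \<or> tsgn E x y = - 1"
  using tournament_edge[of V E x y] by (simp add: tsgn_def)

lemma tsgn_skew:
  "tournament V E \<Longrightarrow> x \<in> V \<Longrightarrow> y \<in> V \<Longrightarrow> tsgn E x y = - tsgn E y x"
  using tournament_edge[of V E x y] tsgn_self[of V E x]
  by (cases "x = y") (simp_all add: tsgn_def)

lemma tsgn_square: "tournament V E \<Longrightarrow> x \<in> V \<Longrightarrow> y \<in> V \<Longrightarrow> tsgn E x y * tsgn E x y = (if x = y then 0 else 1)"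
  using tsgn_cases[of V E x y] tsgn_self[of V E x] by auto

lemma tsgn_row_norm:
  assumes "tournament V E" "x \<in> V"
  shows "(\<Sum>y\<in>V. tsgn E x y * tsgn E x y) = int (card V) - 1"
proof -
  have fin: "finite V" using tournament_finite[OF assms(1)] .
  have "(\<Sum>y\<in>V. tsgn E x y * tsgn E x y) = (\<Sum>y\<in>V. 1 - (if x = y then 1 else 0))"
    using tsgn_square[OF assms] by (intro sum.cong refl) simp
  then show ?thesis using fin assms(2) by (simp add: sum_subtractf)
qed

text \<open>Every entry has the parity of its square, and the squares in a row add up to
  \<open>card V - 1\<close>. On 2d vertices all row sums are therefore odd, in particular
  nonzero.\<close>

lemma tsgn_row_sum_parity:
  assumes "tournament V E" "x \<in> V"
  shows "even ((\<Sum>y\<in>V. tsgn E x y) - (int (card V) - 1))"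
proof -
  have "even (\<Sum>y\<in>V. tsgn E x y - tsgn E x y * tsgn E x y)"
    by (intro dvd_sum) simp
  then show ?thesis using tsgn_row_norm[OF assms] by (simp add: sum_subtractf)
qed

text \<open>Expanding the product of the two sums of rows produces the row norm
  \<open>card V - 1\<close> and the three Gram entries, while modulo 4 only the terms at x, y and z
  survive.\<close>

lemma tsgn_gram_mod4:
  assumes T: "tournament V E" and V: "x \<in> V" "y \<in> V" "z \<in> V" and ne: "x \<noteq> y" "x \<noteq> z" "y \<noteq> z"
  defines "G \<equiv> \<lambda>x y. \<Sum>u\<in>V. tsgn E x u * tsgn E y u"
  shows "4 dvd (int (card V) - 4 + G x y + G x z + G y z)"
proof -
  have fin: "finite V" using tournament_finite[OF T] .
  \<comment> \<open>Each factor below is even when u is none of x, y, z.\<close>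
  let ?f = "\<lambda>u. (tsgn E x u + tsgn E y u) * (tsgn E x u + tsgn E z u)"
  have "(\<Sum>u\<in>V. ?f u) = int (card V) - 1 + G x y + G x z + G y z"
    unfolding G_def tsgn_row_norm[OF T V(1), symmetric]
    by (simp add: algebra_simps sum.distrib)
  moreover have "(\<Sum>u\<in>V. ?f u) = (\<Sum>u\<in>V - {x, y, z}. ?f u) + (?f x + ?f y + ?f z)"
    using sum.subset_diff[of "{x, y, z}" V ?f] fin V ne by (simp add: add.assoc)
  moreover have "4 dvd (\<Sum>u\<in>V - {x, y, z}. ?f u)"
  proof (intro dvd_sum)
    fix u assume u: "u \<in> V - {x, y, z}"
    have "2 dvd tsgn E x u + tsgn E y u" "2 dvd tsgn E x u + tsgn E z u"
      using tsgn_cases[OF T V(1), of u] tsgn_cases[OF T V(2), of u] tsgn_cases[OF T V(3), of u] u by auto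
    then have "2 * 2 dvd ?f u" by (rule mult_dvd_mono)
    then show "4 dvd ?f u" by simp
  qed
  \<comment> \<open>With a, b, c the entries at (x,y), (x,z), (y,z), the three terms add up to 2 +
    ab - ac + bc, and ab - ac + bc is 1 or -3 for all signs.\<close>
  moreover have "4 dvd (?f x + ?f y + ?f z) - 3"
    using tsgn_cases[OF T V(1,2) ne(1)] tsgn_cases[OF T V(1,3) ne(2)] tsgn_cases[OF T V(2,3) ne(3)]
      tsgn_skew[OF T V(2,1)] tsgn_skew[OF T V(3,1)] tsgn_skew[OF T V(3,2)]
      tsgn_self[OF T V(1)] tsgn_self[OF T V(2)] tsgn_self[OF T V(3)] by auto
  ultimately show ?thesis by presburger
qed

section \<open>The balanced block form of T T^T and its row sums\<close>

text \<open>The block form before the vertices are sorted: \<open>\<epsilon>\<close> names the block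
  of each vertex. Letting k and l be integers covers both alternatives, since deleting a vertex of a
  doubly regular tournament gives a negative l.\<close>

definition block_gram :: "nat \<Rightarrow> (nat \<Rightarrow> nat \<Rightarrow> bool) \<Rightarrow> (nat \<Rightarrow> int) \<Rightarrow> int \<Rightarrow> int \<Rightarrow> bool" where
  "block_gram d E \<epsilon> k l \<longleftrightarrow> (\<forall>i<2*d. \<epsilon> i = 1 \<or> \<epsilon> i = - 1) \<and> (\<Sum>i<2*d. \<epsilon> i) = 0 \<and>
     (\<forall>i<2*d. \<forall>j<2*d. (\<Sum>h<2*d. tsgn E i h * tsgn E j h) =
        (if i = j then k else 0) + (if \<epsilon> i = \<epsilon> j then l else 0))"

text \<open>The indicator of equal signs is (1 + \<open>\<epsilon> i * \<epsilon> j\<close>) / 2;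
  doubling makes the Gram matrix a polynomial in the signs without leaving the integers.\<close>

lemma block_gram_twice:
  assumes "block_gram d E \<epsilon> k l" "i < 2*d" "j < 2*d"
  shows "2 * (\<Sum>h<2*d. tsgn E i h * tsgn E j h) = 2 * (if i = j then k else 0) + l * (1 + \<epsilon> i * \<epsilon> j)"
proof -
  have "\<epsilon> i = 1 \<or> \<epsilon> i = - 1" "\<epsilon> j = 1 \<or> \<epsilon> j = - 1"
    "(\<Sum>h<2*d. tsgn E i h * tsgn E j h) = (if i = j then k else 0) + (if \<epsilon> i = \<epsilon> j then l else 0)"
    using assms unfolding block_gram_def by blast+
  then show ?thesis by auto
qed

lemma block_gram_diagonal:
  assumes "tournament {..<2*d} E" "block_gram d E \<epsilon> k l" "d > 0"
  shows "k + l = 2 * int d - 1"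
proof -
  have "(\<Sum>h<2*d. tsgn E 0 h * tsgn E 0 h) = k + l"
    using assms(2,3) by (simp add: block_gram_def)
  then show ?thesis using tsgn_row_norm[OF assms(1), of 0] assms(3) by simp
qed

text \<open>G = T T^T commutes with T and has 1 as an eigenvector for k + ld, so z = T1 is an
  eigenvector for the same value. Skewness makes z orthogonal to 1, and on that complement G takes
  the value k + ld only along \<open>\<epsilon>\<close> because l is nonzero. Thus z = p
  \<open>\<epsilon>\<close>, and p^2 is read off from the norm of z.\<close>

lemma block_gram_row_sums:
  assumes T: "tournament {..<2*d} E" and B: "block_gram d E \<epsilon> k l" and "l \<noteq> 0" "d > 0"
  obtains p where "odd p" "p * p = k + l * int d"
    "\<And>i. i < 2*d \<Longrightarrow> (\<Sum>j<2*d. tsgn E i j) = p * \<epsilon> i"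
    "\<And>i. i < 2*d \<Longrightarrow> (\<Sum>j<2*d. tsgn E i j * \<epsilon> j) = - p"
proof -
  define n where "n = 2 * d"
  define z where "z i = (\<Sum>j<n. tsgn E i j)" for i
  have eps: "\<epsilon> i * \<epsilon> i = 1" if "i < n" for i
    using B that by (auto simp: block_gram_def n_def)
  have eps0: "(\<Sum>i<n. \<epsilon> i) = 0" using B by (simp add: block_gram_def n_def)
  have skew: "tsgn E i j = - tsgn E j i" if "i < n" "j < n" for i j
    using tsgn_skew[OF T, of i j] that by (simp add: n_def)
  note G2 = block_gram_twice[OF B, folded n_def]
  define G where "G i j = (\<Sum>h<n. tsgn E i h * tsgn E j h)" for i j
  have G2: "2 * G i j = 2 * (if i = j then k else 0) + l * (1 + \<epsilon> i * \<epsilon> j)" if "i < n" "j < n" for i j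
    using G2[OF that] by (simp add: G_def)
  have G1: "(\<Sum>j<n. G i j) = k + l * int d" if "i < n" for i
  proof -
    have "2 * (\<Sum>j<n. G i j) = (\<Sum>j<n. 2 * (if i = j then k else 0) + l * (1 + \<epsilon> i * \<epsilon> j))"
      unfolding sum_distrib_left using G2[OF that] by simp
    also have "\<dots> = 2 * k + l * (int n + \<epsilon> i * (\<Sum>j<n. \<epsilon> j))"
      using that by (simp add: sum.distrib flip: sum_distrib_left)
    finally show ?thesis unfolding eps0 by (simp add: n_def algebra_simps)
  qed
  \<comment> \<open>This is T^T T applied to 1; for skew T it agrees with T T^T applied to
    1.\<close>
  have Tz: "(\<Sum>j<n. tsgn E j h * z j) = k + l * int d" if "h < n" for h
  proof -
    have "(\<Sum>j<n. tsgn E j h * z j) = (\<Sum>j<n. \<Sum>g<n. tsgn E h j * tsgn E g j)"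
      unfolding z_def sum_distrib_left
    proof (intro sum.cong refl)
      fix j g assume "j \<in> {..<n}" "g \<in> {..<n}"
      then show "tsgn E j h * tsgn E j g = tsgn E h j * tsgn E g j"
        using skew[of j h] skew[of j g] that by simp
    qed
    also have "\<dots> = (\<Sum>g<n. G h g)" unfolding G_def by (rule sum.swap)
    finally show ?thesis using G1[OF that] by simp
  qed
  have z0: "(\<Sum>i<n. z i) = 0"
  proof -
    have "(\<Sum>i<n. 1 * (\<Sum>j<n. tsgn E i j * 1)) = - (\<Sum>j<n. (\<Sum>i<n. tsgn E j i * 1) * 1)"
      by (rule skew_sum_swap) (rule skew)
    then show ?thesis by (simp add: z_def)
  qed
  define w where "w = (\<Sum>j<n. \<epsilon> j * z j)"
  have dz: "int n * z i = \<epsilon> i * w" if "i < n" for i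
  proof -
    have "(\<Sum>j<n. G i j * z j) = (\<Sum>j<n. \<Sum>h<n. tsgn E i h * (tsgn E j h * z j))"
      by (simp add: G_def sum_distrib_right mult.assoc)
    also have "\<dots> = (\<Sum>h<n. tsgn E i h * (\<Sum>j<n. tsgn E j h * z j))"
      unfolding sum_distrib_left by (rule sum.swap)
    also have "\<dots> = (\<Sum>h<n. tsgn E i h * (k + l * int d))" using Tz by simp
    also have "\<dots> = (k + l * int d) * z i" by (simp add: z_def sum_distrib_left mult.commute)
    finally have "2 * (\<Sum>j<n. G i j * z j) = 2 * (k + l * int d) * z i" by simp
    moreover have "2 * (\<Sum>j<n. G i j * z j) = (\<Sum>j<n. (2 * (if i = j then k else 0) + l * (1 + \<epsilon> i * \<epsilon> j)) * z j)"
      unfolding sum_distrib_left mult.assoc[symmetric] using G2[OF that] by simp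
    moreover have "\<dots> = (\<Sum>j<n. 2 * (if i = j then k * z j else 0) + l * (z j + \<epsilon> i * (\<epsilon> j * z j)))"
      by (intro sum.cong refl) (simp add: algebra_simps)
    moreover have "\<dots> = 2 * (k * z i) + l * ((\<Sum>j<n. z j) + \<epsilon> i * w)"
      using that by (simp add: sum.distrib w_def flip: sum_distrib_left)
    ultimately have "2 * (k + l * int d) * z i = 2 * (k * z i) + l * (0 + \<epsilon> i * w)"
      by (simp only: z0)
    then have "l * (int n * z i) = l * (\<epsilon> i * w)" by (simp add: n_def algebra_simps)
    then show ?thesis using \<open>l \<noteq> 0\<close> by simp
  qed
  define p where "p = \<epsilon> 0 * z 0"
  have n0: "0 < n" using \<open>d > 0\<close> by (simp add: n_def)
  have "int n * p = \<epsilon> 0 * (int n * z 0)" by (simp add: p_def mult.left_commute)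
  also have "\<dots> = (\<epsilon> 0 * \<epsilon> 0) * w" unfolding dz[OF n0] by (rule mult.assoc[symmetric])
  finally have pw: "w = int n * p" by (simp add: eps[OF n0])
  have z: "z i = p * \<epsilon> i" if "i < n" for i
  proof -
    have "int n * z i = int n * (p * \<epsilon> i)" unfolding dz[OF that] pw by (simp add: mult_ac)
    then show ?thesis using n0 by simp
  qed
  have "odd (z 0)"
    using tsgn_row_sum_parity[OF T, of 0] n0 unfolding z_def n_def by simp
  then have p: "odd p" using z[OF n0] by auto
  have "int n * (p * p) = (\<Sum>j<n. z j * z j)"
    using z eps by (simp add: mult.assoc mult.left_commute)
  also have "\<dots> = (\<Sum>j<n. \<Sum>h<n. tsgn E j h * z j)"
    by (simp add: z_def sum_distrib_right)
  also have "\<dots> = (\<Sum>h<n. \<Sum>j<n. tsgn E j h * z j)" by (rule sum.swap)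
  also have "\<dots> = int n * (k + l * int d)" using Tz by simp
  finally have pp: "p * p = k + l * int d" using n0 by simp
  \<comment> \<open>Multiplying by p replaces p \<open>\<epsilon>\<close> by z, where T^T z is
    known; p can be cancelled because it is odd.\<close>
  have "(\<Sum>j<n. tsgn E i j * \<epsilon> j) = - p" if "i < n" for i
  proof -
    have "p * (\<Sum>j<n. tsgn E i j * \<epsilon> j) = (\<Sum>j<n. tsgn E i j * z j)"
      using z by (simp add: sum_distrib_left mult_ac)
    also have "\<dots> = (\<Sum>j<n. - (tsgn E j i * z j))"
      using skew[OF that] by (intro sum.cong refl) simp
    also have "\<dots> = p * (- p)" using Tz[OF that] pp by (simp add: sum_negf)
    finally show ?thesis using p by (metis dvd_0_right mult_cancel_left)
  qed
  then show ?thesis using that[OF p pp] z unfolding z_def n_def by blast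
qed

text \<open>The code as an indexed family, with \<open>x i h\<close> the coordinates of vector i.
  Distinctness of the vectors will come from b > 0, which makes every off-diagonal entry
  non-real.\<close>

definition gram_representation :: "nat \<Rightarrow> (nat \<Rightarrow> nat \<Rightarrow> bool) \<Rightarrow> real \<Rightarrow> real \<Rightarrow> (nat \<Rightarrow> nat \<Rightarrow> complex) \<Rightarrow> bool" where
  "gram_representation d E a b x \<longleftrightarrow> (\<forall>i<2*d. \<forall>j<2*d. (\<Sum>h<d. cnj (x i h) * x j h) =
     (if i = j then 1 else a + \<i> * b * of_int (tsgn E i j)))"

subsection \<open>Gram vectors from the block form\<close>

text \<open>On the complement of 1 and \<open>\<epsilon>\<close>, which T preserves, T^2 = -c^2, so
  (T - i c)(T + i c) = 0 and \<open>L\<close> = T + i c lands in the eigenspace for i c. It also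
  preserves orthogonality to eigenvectors already found, which allows the greedy extension.\<close>

lemma eigenvector_family:
  fixes T :: "nat \<Rightarrow> nat \<Rightarrow> complex" and \<epsilon> :: "nat \<Rightarrow> complex" and c p :: real
  assumes n: "n = 2 * m + 2"
    and skew: "\<And>i j. i < n \<Longrightarrow> j < n \<Longrightarrow> T i j = - T j i"
    and Tr: "\<And>i j. cnj (T i j) = T i j"
    and er: "\<And>i. cnj (\<epsilon> i) = \<epsilon> i"
    and "c \<noteq> 0"
    and T1: "\<And>i. i < n \<Longrightarrow> (\<Sum>j<n. T i j) = p * \<epsilon> i"
    and Te: "\<And>i. i < n \<Longrightarrow> (\<Sum>j<n. T i j * \<epsilon> j) = - p"
    and TT: "\<And>w i. (\<Sum>j<n. w j) = 0 \<Longrightarrow> (\<Sum>j<n. \<epsilon> j * w j) = 0 \<Longrightarrow> i < n \<Longrightarrow>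
               (\<Sum>j<n. T i j * (\<Sum>h<n. T j h * w h)) = - (complex_of_real c * complex_of_real c) * w i"
  shows "\<exists>v. orthonormal n m v \<and> (\<forall>a<m. (\<Sum>i<n. v a i) = 0 \<and> (\<Sum>i<n. \<epsilon> i * v a i) = 0 \<and>
           (\<forall>i<n. (\<Sum>j<n. T i j * v a j) = \<i> * c * v a i))"
proof -
  define K where "K w \<longleftrightarrow> (\<Sum>i<n. w i) = 0 \<and> (\<Sum>i<n. \<epsilon> i * w i) = 0 \<and>
    (\<forall>i<n. (\<Sum>j<n. T i j * w j) = \<i> * c * w i)" for w
  have swap: "(\<Sum>i<n. a i * (\<Sum>j<n. T i j * b j)) = - (\<Sum>j<n. (\<Sum>i<n. T j i * a i) * b j)" for a b
    by (rule skew_sum_swap) (rule skew)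
  define L where "L y i = (\<Sum>j<n. T i j * y j) + \<i> * c * y i" for y i
  have LK: "K (L y)" and Lorth: "\<And>v. K v \<Longrightarrow> (\<Sum>i<n. cnj (v i) * y i) = 0 \<Longrightarrow> (\<Sum>i<n. cnj (v i) * L y i) = 0"
    if y: "(\<Sum>i<n. y i) = 0" "(\<Sum>i<n. \<epsilon> i * y i) = 0" for y
  proof -
    have "(\<Sum>i<n. \<Sum>j<n. T i j * y j) = - (\<Sum>j<n. p * (\<epsilon> j * y j))"
      using swap[of "\<lambda>_. 1" y] T1 by (simp add: mult.assoc)
    then have a: "(\<Sum>i<n. \<Sum>j<n. T i j * y j) = 0"
      by (simp add: y flip: sum_distrib_left)
    have "(\<Sum>i<n. \<epsilon> i * (\<Sum>j<n. T i j * y j)) = (\<Sum>j<n. p * y j)"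
      using swap[of \<epsilon> y] Te by (simp add: sum_negf)
    then have b: "(\<Sum>i<n. \<epsilon> i * (\<Sum>j<n. T i j * y j)) = 0"
      by (simp add: y flip: sum_distrib_left)
    show "K (L y)"
      unfolding K_def
    proof (intro conjI allI impI)
      show "(\<Sum>i<n. L y i) = 0"
        by (simp add: L_def sum.distrib a y flip: sum_distrib_left)
      have "(\<Sum>i<n. \<epsilon> i * L y i) = (\<Sum>i<n. \<epsilon> i * (\<Sum>j<n. T i j * y j)) + \<i> * c * (\<Sum>i<n. \<epsilon> i * y i)"
        unfolding L_def sum_distrib_left[of "\<i> * c"] sum.distrib[symmetric]
        by (intro sum.cong refl) (simp add: distrib_left mult_ac)
      then show "(\<Sum>i<n. \<epsilon> i * L y i) = 0" by (simp add: b y)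
    next
      fix i assume "i < n"
      have "(\<Sum>j<n. T i j * L y j) = (\<Sum>j<n. T i j * (\<Sum>h<n. T j h * y h)) + \<i> * c * (\<Sum>j<n. T i j * y j)"
        unfolding L_def sum_distrib_left[of "\<i> * c"] sum.distrib[symmetric]
        by (intro sum.cong refl) (simp add: distrib_left mult_ac)
      then show "(\<Sum>j<n. T i j * L y j) = \<i> * c * L y i"
        using TT[OF y \<open>i < n\<close>] by (simp add: L_def algebra_simps)
    qed
    show "(\<Sum>i<n. cnj (v i) * L y i) = 0" if v: "K v" "(\<Sum>i<n. cnj (v i) * y i) = 0" for v
    proof -
      have "(\<Sum>j<n. T i j * cnj (v j)) = - (\<i> * c * cnj (v i))" if "i < n" for i
      proof -
        have "(\<Sum>j<n. T i j * cnj (v j)) = cnj (\<Sum>j<n. T i j * v j)" by (simp add: Tr)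
        also have "(\<Sum>j<n. T i j * v j) = \<i> * c * v i" using v(1) that unfolding K_def by blast
        finally show ?thesis by simp
      qed
      then have "(\<Sum>i<n. cnj (v i) * (\<Sum>j<n. T i j * y j)) = (\<Sum>j<n. \<i> * c * (cnj (v j) * y j))"
        using swap[of "\<lambda>i. cnj (v i)" y] by (simp add: sum_negf mult.assoc)
      also have "\<dots> = 0" using v(2) by (simp flip: sum_distrib_left)
      finally have *: "(\<Sum>i<n. cnj (v i) * (\<Sum>j<n. T i j * y j)) = 0" .
      have "(\<Sum>i<n. cnj (v i) * L y i) = (\<Sum>i<n. cnj (v i) * (\<Sum>j<n. T i j * y j)) + \<i> * c * (\<Sum>i<n. cnj (v i) * y i)"
        unfolding L_def sum_distrib_left[of "\<i> * c"] sum.distrib[symmetric]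
        by (intro sum.cong refl) (simp add: distrib_left mult_ac)
      then show ?thesis using * v(2) by simp
    qed
  qed
  have "\<exists>v. orthonormal n m v \<and> (\<forall>a<m. K (v a))"
  proof (rule orthonormal_greedy)
    fix w s assume w: "K w"
    have "(\<Sum>i<n. f i * (s * w i)) = s * (\<Sum>i<n. f i * w i)" for f
      unfolding sum_distrib_left by (intro sum.cong refl) (simp add: mult_ac)
    then show "K (\<lambda>i. s * w i)"
      using w by (simp add: K_def mult_ac flip: sum_distrib_left)
  next
    fix m' v assume "m' < m" and v: "orthonormal n m' v" "\<forall>a<m'. K (v a)"
    \<comment> \<open>Orthogonality to both the chosen vectors and their conjugates makes y and its
      conjugate equally usable. These are 2 + 2m' equations, fewer than n = 2m + 2.\<close>
    let ?L = "[\<lambda>_. 1, \<epsilon>] @ map (\<lambda>a i. cnj (v a i)) [0..<m'] @ map v [0..<m']"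
    have "length ?L < n" using \<open>m' < m\<close> n by simp
    from homogeneous_system_nontrivial[OF this] obtain y where
      y: "\<exists>i<n. y i \<noteq> 0" "\<forall>a\<in>set ?L. (\<Sum>i<n. a i * y i) = 0" by blast
    from y(2) have y1: "(\<Sum>i<n. y i) = 0" "(\<Sum>i<n. \<epsilon> i * y i) = 0"
      and yv: "\<And>a. a < m' \<Longrightarrow> (\<Sum>i<n. cnj (v a i) * y i) = 0" "\<And>a. a < m' \<Longrightarrow> (\<Sum>i<n. v a i * y i) = 0"
      by auto
    define y' where "y' i = cnj (y i)" for i
    have y1': "(\<Sum>i<n. y' i) = 0" "(\<Sum>i<n. \<epsilon> i * y' i) = 0"
      using arg_cong[OF y1(1), of cnj] arg_cong[OF y1(2), of cnj] by (simp_all add: y'_def er)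
    have yv': "(\<Sum>i<n. cnj (v a i) * y' i) = 0" if "a < m'" for a
      using arg_cong[OF yv(2)[OF that], of cnj] by (simp add: y'_def)
    \<comment> \<open>L maps to the eigenspace; it cannot kill both y and its conjugate.\<close>
    have "(\<exists>i<n. L y i \<noteq> 0) \<or> (\<exists>i<n. L y' i \<noteq> 0)"
    proof (rule ccontr)
      assume neg: "\<not> ?thesis"
      obtain i where i: "i < n" "y i \<noteq> 0" using y(1) by blast
      from neg i(1) have "L y i = 0" "cnj (L y' i) = 0" by auto
      then have "(\<Sum>j<n. T i j * y j) + \<i> * c * y i = 0" "(\<Sum>j<n. T i j * y j) - \<i> * c * y i = 0"
        by (simp_all add: L_def y'_def Tr)
      then have "2 * (\<i> * c * y i) = 0" by (simp add: algebra_simps)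
      then show False using i(2) \<open>c \<noteq> 0\<close> by simp
    qed
    then show "\<exists>w. K w \<and> (\<exists>i<n. w i \<noteq> 0) \<and> (\<forall>a<m'. (\<Sum>i<n. cnj (v a i) * w i) = 0)"
    proof
      assume "\<exists>i<n. L y i \<noteq> 0"
      then show ?thesis using LK[OF y1] Lorth[OF y1] yv(1) v(2) by blast
    next
      assume "\<exists>i<n. L y' i \<noteq> 0"
      then show ?thesis using LK[OF y1'] Lorth[OF y1'] yv' v(2) by blast
    qed
  qed
  then show ?thesis unfolding K_def .
qed

text \<open>iT has eigenvalue -c on d - 1 vectors, c on their conjugates, and acts on the span of 1
  and \<open>\<epsilon>\<close> through p. Adding cI kills the first eigenspace, and a suitable
  multiple of J lowers the rank by one more, to d, which is the number of coordinates
  available.\<close>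

lemma block_gram_vectors:
  assumes T: "tournament {..<2*d} E" and B: "block_gram d E \<epsilon> k l"
    and "k > 0" "l \<noteq> 0" "d > 0"
  shows "\<exists>a b x. b > 0 \<and> gram_representation d E a b x"
proof -
  obtain p where "odd p" and p: "p * p = k + l * int d"
    and T1: "\<And>i. i < 2*d \<Longrightarrow> (\<Sum>j<2*d. tsgn E i j) = p * \<epsilon> i"
    and Te: "\<And>i. i < 2*d \<Longrightarrow> (\<Sum>j<2*d. tsgn E i j * \<epsilon> j) = - p"
    by (rule block_gram_row_sums[OF T B \<open>l \<noteq> 0\<close> \<open>d > 0\<close>]) (rule that)
  define n where "n = 2 * d"
  define m where "m = d - 1"
  have nm: "n = 2 * m + 2" and dm: "d = Suc m" using \<open>d > 0\<close> by (auto simp: n_def m_def)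
  define A :: "nat \<Rightarrow> nat \<Rightarrow> complex" where "A i j = of_int (tsgn E i j)" for i j
  define e :: "nat \<Rightarrow> complex" where "e i = of_int (\<epsilon> i)" for i
  define c where "c = sqrt (of_int k)"
  define P where "P = real_of_int p"
  have c: "c > 0" "c * c = of_int k" using \<open>k > 0\<close> by (auto simp: c_def)
  have cc: "complex_of_real c * complex_of_real c = of_int k"
    using c(2) by (metis of_real_mult of_real_of_int_eq)
  have skew: "A i j = - A j i" if "i < n" "j < n" for i j
    using tsgn_skew[OF T, of i j] that by (simp add: A_def n_def)
  have A1: "(\<Sum>j<n. A i j) = P * e i" if "i < n" for i
    using arg_cong[OF T1, of i "of_int :: int \<Rightarrow> complex"] that by (simp add: A_def e_def P_def n_def)
  have Ae: "(\<Sum>j<n. A i j * e j) = - P" if "i < n" for i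
    using arg_cong[OF Te, of i "of_int :: int \<Rightarrow> complex"] that by (simp add: A_def e_def P_def n_def)
  have AA: "(\<Sum>j<n. A i j * (\<Sum>h<n. A j h * w h)) = - (complex_of_real c * complex_of_real c) * w i"
    if w: "(\<Sum>j<n. w j) = 0" "(\<Sum>j<n. e j * w j) = 0" and "i < n" for w i
  proof -
    define g where "g h = (\<Sum>j<n. A i j * A h j)" for h
    have G: "2 * g h = 2 * (if i = h then of_int k else 0) + of_int l * (1 + e i * e h)"
      if "h < n" for h
      using arg_cong[OF block_gram_twice[OF B, of i h], of "of_int :: int \<Rightarrow> complex"] that \<open>i < n\<close>
      by (simp add: g_def A_def e_def n_def if_distrib cong: if_cong)
    have "(\<Sum>j<n. A i j * (\<Sum>h<n. A j h * w h)) = (\<Sum>h<n. \<Sum>j<n. A i j * (A j h * w h))"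
      unfolding sum_distrib_left by (rule sum.swap)
    also have "\<dots> = (\<Sum>h<n. - (g h * w h))"
      unfolding g_def sum_distrib_right sum_negf[symmetric]
    proof (intro sum.cong refl)
      fix h j assume "h \<in> {..<n}" "j \<in> {..<n}"
      then show "A i j * (A j h * w h) = - (A i j * A h j * w h)" using skew[of j h] by simp
    qed
    finally have "2 * (\<Sum>j<n. A i j * (\<Sum>h<n. A j h * w h)) = - (\<Sum>h<n. (2 * g h) * w h)"
      by (simp add: sum_negf sum_distrib_left mult.assoc)
    also have "(\<Sum>h<n. (2 * g h) * w h) =
      (\<Sum>h<n. (2 * (if i = h then of_int k else 0) + of_int l * (1 + e i * e h)) * w h)"
      using G by (intro sum.cong refl) simp
    also have "\<dots> = (\<Sum>h<n. 2 * (if i = h then of_int k * w h else 0) + of_int l * (w h + e i * (e h * w h)))"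
      by (intro sum.cong refl) (simp add: algebra_simps)
    also have "\<dots> = 2 * of_int k * w i"
      using \<open>i < n\<close> by (simp add: sum.distrib w flip: sum_distrib_left)
    finally show ?thesis by (simp add: cc)
  qed
  obtain v where on: "orthonormal n m v" and v: "\<And>a. a < m \<Longrightarrow> (\<Sum>i<n. v a i) = 0"
    "\<And>a. a < m \<Longrightarrow> (\<Sum>i<n. e i * v a i) = 0"
    "\<And>a i. a < m \<Longrightarrow> i < n \<Longrightarrow> (\<Sum>j<n. A i j * v a j) = \<i> * c * v a i"
    using eigenvector_family[OF nm skew _ _ _ A1 Ae AA] c(1) by (auto simp: A_def e_def)
  have ee: "e i * e i = 1" if "i < n" for i
    using B that unfolding block_gram_def e_def n_def by fastforce
  have e0: "(\<Sum>i<n. e i) = 0"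
    using B unfolding block_gram_def e_def n_def by (metis of_int_0 of_int_sum)
  define Q where "Q i j = (\<Sum>a<m. v a i * cnj (v a j))" for i j
  define Q' where "Q' i j = (\<Sum>a<m. cnj (v a i) * v a j)" for i j
  have compl: "Q i j + Q' i j + 1 / of_nat n + e i * e j / of_nat n = (if i = j then 1 else 0)"
    if "i < n" "j < n" for i j
    using completeness_conjugate_pairs[OF nm skew _ on v(3) v(1) v(2) _ e0, of "real n" i j] c(1) that ee nm
    by (simp add: Q_def Q'_def e_def)
  have eigc: "(\<Sum>j<n. A i j * cnj (v a j)) = - (\<i> * c * cnj (v a i))" if "a < m" "i < n" for a i
    using arg_cong[OF v(3)[OF that], of cnj] by (simp add: A_def)
  \<comment> \<open>T applied to the resolution of the identity: its spectral decomposition, with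
    the action on 1 and \<open>\<epsilon>\<close> as the last two terms.\<close>
  have AQ: "\<i> * c * (Q i j - Q' i j) + P * e i / of_nat n - P * e j / of_nat n = A i j" if "i < n" "j < n" for i j
  proof -
    have "(\<Sum>h<n. A i h * Q h j) = (\<Sum>a<m. (\<Sum>h<n. A i h * v a h) * cnj (v a j))"
      unfolding Q_def sum_distrib_left sum_distrib_right
      by (subst sum.swap) (simp add: mult.assoc)
    also have "\<dots> = \<i> * c * Q i j"
      using v(3) that by (simp add: Q_def sum_distrib_left mult.assoc)
    finally have 1: "(\<Sum>h<n. A i h * Q h j) = \<i> * c * Q i j" .
    have "(\<Sum>h<n. A i h * Q' h j) = (\<Sum>a<m. (\<Sum>h<n. A i h * cnj (v a h)) * v a j)"
      unfolding Q'_def sum_distrib_left sum_distrib_right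
      by (subst sum.swap) (simp add: mult.assoc)
    also have "\<dots> = - (\<i> * c * Q' i j)"
      using eigc that by (simp add: Q'_def sum_distrib_left mult.assoc sum_negf)
    finally have 2: "(\<Sum>h<n. A i h * Q' h j) = - (\<i> * c * Q' i j)" .
    have "A i j = (\<Sum>h<n. A i h * (if h = j then 1 else 0))"
      using that by (simp add: if_distrib[of "\<lambda>x. _ * x"] cong: if_cong)
    also have "\<dots> = (\<Sum>h<n. A i h * (Q h j + Q' h j + 1 / of_nat n + e h * e j / of_nat n))"
      using compl[OF _ that(2)] by (intro sum.cong refl) simp
    also have "\<dots> = (\<Sum>h<n. A i h * Q h j) + (\<Sum>h<n. A i h * Q' h j) + (\<Sum>h<n. A i h) / of_nat n
        + (\<Sum>h<n. A i h * e h) * e j / of_nat n"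
      by (simp add: algebra_simps sum.distrib sum_divide_distrib sum_distrib_left)
    finally show ?thesis using 1 2 A1[OF that(1)] Ae[OF that(1)] by (simp add: algebra_simps)
  qed
  \<comment> \<open>On the unit vectors along 1 and \<open>\<epsilon>\<close>, iT + cI + tJ has
    diagonal c + tn, c and off-diagonal entries with product p^2. As p^2 = c^2 + ld, the determinant
    c(c + tn) - p^2 vanishes exactly for this t.\<close>
  define t where "t = of_int l / (2 * c)"
  \<comment> \<open>The matrix iT + cI + tJ equals 2c times the projection onto the conjugate eigenvectors
    plus the rank one matrix of c e + iP 1, divided by cn.\<close>
  define x where "x i h = (if h < m then sqrt (2 * c) * v h i else (c * e i + \<i> * P) / sqrt (c * n))" for i h
  have gram: "(\<Sum>h<d. cnj (x i h) * x j h) = (if i = j then complex_of_real c else 0) + t + \<i> * A i j"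
    if ij: "i < n" "j < n" for i j
  proof -
    have nz: "complex_of_real c \<noteq> 0" "complex_of_nat n \<noteq> 0" "complex_of_nat d \<noteq> 0"
      using c(1) \<open>d > 0\<close> by (simp_all add: n_def)
    have PP: "complex_of_real P * P = c * c + of_int l * of_nat d"
      using arg_cong[OF p, of "of_int :: int \<Rightarrow> complex"] by (simp add: P_def cc)
    have s2c: "complex_of_real (sqrt (2 * c)) * sqrt (2 * c) = 2 * c"
      using c(1) by (metis of_real_mult of_real_numeral real_sqrt_mult_self abs_of_pos mult_pos_pos zero_less_numeral)
    have scn: "complex_of_real (sqrt (c * n)) * sqrt (c * n) = c * n"
      using c(1) by (metis of_real_mult real_sqrt_mult_self abs_of_nonneg mult_nonneg_nonneg of_nat_0_le_iff less_imp_le of_real_of_nat_eq)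
    have "(\<Sum>h<d. cnj (x i h) * x j h) = (\<Sum>h<m. cnj (x i h) * x j h) + cnj (x i m) * x j m"
      by (simp add: dm)
    also have "(\<Sum>h<m. cnj (x i h) * x j h) = 2 * c * Q' i j"
      unfolding Q'_def sum_distrib_left s2c[symmetric] by (intro sum.cong refl) (simp add: x_def mult_ac)
    also have "cnj (x i m) * x j m = (c * e i - \<i> * P) * (c * e j + \<i> * P) / (c * n)"
      unfolding scn[symmetric] by (simp add: x_def e_def)
    also have "\<dots> = c * e i * e j / n + \<i> * P * e i / n - \<i> * P * e j / n + (P * P) / (c * n)"
      using nz by (simp add: field_simps)
    also have "P * P / (c * n) = complex_of_real c / n + t"
      using nz PP by (simp add: t_def field_simps n_def)
    \<comment> \<open>Q' is eliminated through its sum with Q, known from completeness, and its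
      difference from Q, known from the spectral decomposition.\<close>
    also have "2 * c * Q' i j = c * ((Q i j + Q' i j) - (Q i j - Q' i j))" by simp
    also have "Q i j + Q' i j = (if i = j then 1 else 0) - 1 / n - e i * e j / n"
      using compl[OF ij] by (simp add: algebra_simps)
    also have "Q i j - Q' i j = - (\<i> * (A i j - P * e i / n + P * e j / n)) / c"
      using nz unfolding AQ[OF ij, symmetric] by (simp add: field_simps)
    also have "c * (((if i = j then 1 else 0) - 1 / n - e i * e j / n) - - (\<i> * (A i j - P * e i / n + P * e j / n)) / c)
        + (c * e i * e j / n + \<i> * P * e i / n - \<i> * P * e j / n + (complex_of_real c / n + t))
      = (if i = j then complex_of_real c else 0) + t + \<i> * A i j"
      using nz by (cases "i = j") (simp_all add: field_simps)
    finally show ?thesis .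
  qed
  \<comment> \<open>The common diagonal entry c + t is the squared length to be normalised. It has
    the sign of 2k + l = k + (2d - 1), which is positive even for negative l.\<close>
  have "k + l = 2 * int d - 1" by (rule block_gram_diagonal[OF T B \<open>d > 0\<close>])
  then have "0 < 2 * k + l" using \<open>k > 0\<close> \<open>d > 0\<close> by simp
  then have "0 < 2 * (c * c) + of_int l" unfolding c(2) by (metis of_int_0_less_iff of_int_add of_int_mult of_int_numeral)
  moreover have "c + t = (2 * (c * c) + of_int l) / (2 * c)"
    using c(1) by (simp add: t_def field_simps)
  ultimately have ct: "c + t > 0" using c(1) by simp
  define x' where "x' i h = x i h / sqrt (c + t)" for i h
  have "gram_representation d E (t / (c + t)) (1 / (c + t)) x'"
    unfolding gram_representation_def
  proof (intro allI impI)
    fix i j assume ij: "i < 2 * d" "j < 2 * d"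
    have ss: "complex_of_real (sqrt (c + t)) * sqrt (c + t) = c + t"
      using ct by (metis of_real_mult real_sqrt_mult_self abs_of_pos)
    have "(\<Sum>h<d. cnj (x' i h) * x' j h) = (\<Sum>h<d. cnj (x i h) * x j h) / (c + t)"
      unfolding ss[symmetric] x'_def by (simp add: sum_divide_distrib)
    also have "\<dots> = ((if i = j then complex_of_real c else 0) + t + \<i> * A i j) / (c + t)"
      using gram ij by (simp add: n_def)
    also have "\<dots> = (if i = j then 1 else complex_of_real (t / (c + t)) + \<i> * complex_of_real (1 / (c + t)) * of_int (tsgn E i j))"
    proof (cases "i = j")
      case True
      have "complex_of_real (c + t) \<noteq> 0" using ct by (simp only: of_real_eq_0_iff)
      then show ?thesis using tsgn_self[OF T, of j] ij True by (simp add: A_def)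
    next
      case False
      then show ?thesis by (simp add: A_def add_divide_distrib)
    qed
    finally show "(\<Sum>h<d. cnj (x' i h) * x' j h) =
      (if i = j then 1 else complex_of_real (t / (c + t)) + \<i> * complex_of_real (1 / (c + t)) * of_int (tsgn E i j))" .
  qed
  moreover have "1 / (c + t) > 0" using ct by simp
  ultimately show ?thesis by blast
qed

subsection \<open>The block form from Gram vectors\<close>

lemma gram_representation_real_part_less_1:
  assumes T: "tournament {..<2*d} E" and "d \<ge> 2" and "b > 0" and R: "gram_representation d E a b x"
  shows "a < 1"
proof -
  \<comment> \<open>Test the Gram form on the vectors (1 + i, -1, -i) and their conjugates, which are orthogonal to 1:
    the imaginary parts of the angles contribute a nonzero odd multiple with opposite signs.\<close>
  define H where "H i j = (\<Sum>h<d. cnj (x i h) * x j h)" for i j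
  define \<tau> where "\<tau> = tsgn E 0 1 + tsgn E 1 2 - tsgn E 0 2"
  have lt: "0 < 2 * d" "1 < 2 * d" "2 < 2 * d" using \<open>d \<ge> 2\<close> by auto
  have H: "H i j = (if i = j then 1 else a + \<i> * b * of_int (tsgn E i j))" if "i < 2 * d" "j < 2 * d" for i j
    using R that by (simp add: gram_representation_def H_def)
  have nn: "0 \<le> 4 * (1 - a) - 2 * s * b * of_int \<tau>" if s: "s * s = 1" for s :: real
  proof -
    have ss: "complex_of_real s * (complex_of_real s * u) = u" for u
      using arg_cong[OF s, of complex_of_real] by (simp flip: mult.assoc)
    define y where "y h = (1 + s * \<i>) * x 0 h - x 1 h - s * \<i> * x 2 h" for h
    have "(\<Sum>h<d. cnj (y h) * y h) = 2 * H 0 0 - (1 - s * \<i>) * H 0 1 - (1 + s * \<i>) * H 0 2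
       - (1 + s * \<i>) * H 1 0 + H 1 1 + s * \<i> * H 1 2 - (1 - s * \<i>) * H 2 0 - s * \<i> * H 2 1 + H 2 2"
      unfolding H_def sum_distrib_left sum.distrib[symmetric] sum_subtractf[symmetric]
      by (intro sum.cong refl) (simp add: y_def algebra_simps ss)
    also have "\<dots> = of_real (4 * (1 - a) - 2 * s * b * of_int \<tau>)"
      using H lt tsgn_skew[OF T, of 1 0] tsgn_skew[OF T, of 2 0] tsgn_skew[OF T, of 2 1]
      by (simp add: \<tau>_def algebra_simps)
    finally have "complex_of_real (4 * (1 - a) - 2 * s * b * of_int \<tau>) = (\<Sum>h<d. cnj (y h) * y h)" ..
    also have "\<dots> = of_real (\<Sum>h<d. (cmod (y h))\<^sup>2)"
      unfolding of_real_sum complex_norm_square by (intro sum.cong refl) (rule mult.commute)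
    finally have "4 * (1 - a) - 2 * s * b * of_int \<tau> = (\<Sum>h<d. (cmod (y h))\<^sup>2)"
      by (simp only: of_real_eq_iff)
    then show ?thesis by (simp add: sum_nonneg)
  qed
  have "tsgn E 0 1 = 1 \<or> tsgn E 0 1 = - 1" "tsgn E 1 2 = 1 \<or> tsgn E 1 2 = - 1"
    "tsgn E 0 2 = 1 \<or> tsgn E 0 2 = - 1"
    using lt by (simp_all add: tsgn_cases[OF T])
  then have "\<tau> \<noteq> 0" unfolding \<tau>_def by (elim disjE) simp_all
  define u where "u = b * \<bar>of_int \<tau>\<bar>"
  have "u > 0" using \<open>b > 0\<close> \<open>\<tau> \<noteq> 0\<close> by (simp add: u_def)
  moreover have "0 \<le> 4 * (1 - a) - 2 * u"
    using nn[of 1] nn[of "- 1"] by (auto simp: u_def abs_if)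
  ultimately have "0 < 4 * (1 - a)" by argo
  then show ?thesis by simp
qed

text \<open>T is known on the whole basis: i c and -i c on the eigenvectors and their conjugates, T1
  = z, Tz = -(q/n) 1. Hence T T^T = -T^2 is c^2 on the former and q/n on the span of 1 and z, onto
  which J/n + z z^T/q is the orthogonal projection.\<close>

lemma gram_representation_imp_row_formula:
  assumes T: "tournament {..<2*d} E" and "d \<ge> 2" and "b > 0" and R: "gram_representation d E a b x"
    and z_def: "\<And>i. z i = (\<Sum>j<2*d. tsgn E i j)"
    and q_def: "q = real_of_int (\<Sum>i<2*d. z i * z i)"
  shows "\<exists>c > 0. \<forall>i<2*d. \<forall>j<2*d. real_of_int (\<Sum>h<2*d. tsgn E i h * tsgn E j h) =
    (if i = j then c\<^sup>2 else 0) + (q / (2 * real d) - c\<^sup>2) * (1 / (2 * real d) + of_int (z i) * of_int (z j) / q)"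
proof -
  \<comment> \<open>For w orthogonal to 1 in the kernel of the Gram matrix, (1 - a) w + i b T w = 0,
    that is, T w = i c w.\<close>
  define c where "c = (1 - a) / b"
  have "c > 0" using gram_representation_real_part_less_1[OF T \<open>d \<ge> 2\<close> \<open>b > 0\<close> R] \<open>b > 0\<close> by (simp add: c_def)
  have nz: "complex_of_real b \<noteq> 0" "complex_of_real c \<noteq> 0" using \<open>b > 0\<close> \<open>c > 0\<close> by auto
  define n where "n = 2 * d"
  define m where "m = d - 1"
  have nm: "n = 2 * m + 2" using \<open>d \<ge> 2\<close> by (auto simp: n_def m_def)
  define A :: "nat \<Rightarrow> nat \<Rightarrow> complex" where "A i j = of_int (tsgn E i j)" for i j
  have skew: "A i j = - A j i" if "i < n" "j < n" for i j
    using tsgn_skew[OF T, of i j] that by (simp add: A_def n_def)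
  have swap: "(\<Sum>i<n. f i * (\<Sum>j<n. A i j * g j)) = - (\<Sum>j<n. (\<Sum>i<n. A j i * f i) * g j)" for f g
    by (rule skew_sum_swap) (rule skew)
  \<comment> \<open>These are d + 1 linear conditions on 2d unknowns, which leaves room for m = d -
    1 orthonormal solutions. Vanishing against every coordinate of the Gram vectors puts w in the
    kernel of the Gram matrix.\<close>
  define K where "K w \<longleftrightarrow> (\<Sum>i<n. w i) = 0 \<and> (\<forall>h<d. (\<Sum>i<n. x i h * w i) = 0)" for w
  have Keig: "(\<Sum>j<n. A i j * w j) = \<i> * c * w i" if w: "K w" and "i < n" for w i
  proof -
    have "(\<Sum>j<n. (\<Sum>h<d. cnj (x i h) * x j h) * w j) = (\<Sum>h<d. cnj (x i h) * (\<Sum>j<n. x j h * w j))"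
      unfolding sum_distrib_left sum_distrib_right mult.assoc by (rule sum.swap)
    also have "\<dots> = 0" using w by (simp add: K_def)
    finally have "0 = (\<Sum>j<n. (\<Sum>h<d. cnj (x i h) * x j h) * w j)" ..
    also have "\<dots> = (\<Sum>j<n. (1 - a) * (if i = j then w j else 0) + a * w j + \<i> * b * (A i j * w j))"
    proof (intro sum.cong refl)
      fix j assume "j \<in> {..<n}"
      then have "(\<Sum>h<d. cnj (x i h) * x j h) = (if i = j then 1 else a + \<i> * b * A i j)"
        using R \<open>i < n\<close> by (simp add: gram_representation_def n_def A_def)
      moreover have "A i i = 0" using tsgn_self[OF T, of i] \<open>i < n\<close> by (simp add: A_def n_def)
      ultimately show "(\<Sum>h<d. cnj (x i h) * x j h) * w j =
        (1 - a) * (if i = j then w j else 0) + a * w j + \<i> * b * (A i j * w j)"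
        by (auto simp: algebra_simps)
    qed
    also have "\<dots> = (1 - a) * w i + \<i> * b * (\<Sum>j<n. A i j * w j)"
      using w \<open>i < n\<close> by (simp add: sum.distrib K_def flip: sum_distrib_left)
    finally have "\<i> * b * (\<Sum>j<n. A i j * w j) = - ((1 - a) * w i)"
      by (simp add: eq_neg_iff_add_eq_0 add.commute)
    also have "\<dots> = \<i> * b * (\<i> * c * w i)" using nz(1) by (simp add: c_def)
    finally show ?thesis using nz(1) by simp
  qed
  have "\<exists>v. orthonormal n m v \<and> (\<forall>a<m. K (v a))"
  proof (rule orthonormal_greedy)
    fix w s assume w: "K w"
    have "(\<Sum>i<n. f i * (s * w i)) = s * (\<Sum>i<n. f i * w i)" for f
      unfolding sum_distrib_left by (intro sum.cong refl) (simp add: mult_ac)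
    then show "K (\<lambda>i. s * w i)"
      using w by (simp add: K_def flip: sum_distrib_left)
  next
    fix m' v assume "m' < m" and v: "orthonormal n m' v" "\<forall>a<m'. K (v a)"
    let ?L = "[\<lambda>_. 1] @ map (\<lambda>h i. x i h) [0..<d] @ map (\<lambda>a i. cnj (v a i)) [0..<m']"
    have "length ?L < n" using \<open>m' < m\<close> by (simp add: n_def m_def)
    from homogeneous_system_nontrivial[OF this] obtain y where
      y: "\<exists>i<n. y i \<noteq> 0" "\<forall>a\<in>set ?L. (\<Sum>i<n. a i * y i) = 0" by blast
    then show "\<exists>w. K w \<and> (\<exists>i<n. w i \<noteq> 0) \<and> (\<forall>a<m'. (\<Sum>i<n. cnj (v a i) * w i) = 0)"
      by (intro exI[of _ y]) (simp add: K_def ball_Un)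
  qed
  then obtain v where on: "orthonormal n m v" and v: "\<And>a. a < m \<Longrightarrow> K (v a)" by blast
  note eig = Keig[OF v]
  have v1: "(\<Sum>i<n. v a i) = 0" if "a < m" for a using v[OF that] by (simp add: K_def)
  define Z where "Z i = complex_of_int (z i)" for i
  have Z: "Z i = (\<Sum>j<n. A i j)" for i by (simp add: Z_def z_def A_def n_def)
  have Zr: "cnj (Z i) = Z i" for i by (simp add: Z_def)
  have Z0: "(\<Sum>i<n. Z i) = 0"
    using swap[of "\<lambda>_. 1" "\<lambda>_. 1"] by (simp add: Z)
  have vZ: "(\<Sum>i<n. Z i * v a i) = 0" if "a < m" for a
  proof -
    have "(\<Sum>i<n. Z i * v a i) = - (\<Sum>i<n. \<i> * c * v a i)"
      using swap[of "\<lambda>_. 1" "v a"] eig[OF that] by (simp add: Z)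
    then show ?thesis using v1[OF that] by (simp flip: sum_distrib_left)
  qed
  have qZ: "(\<Sum>i<n. Z i * Z i) = of_real q" by (simp add: q_def Z_def n_def)
  have "odd (z 0)" 
    using tsgn_row_sum_parity[OF T, of 0] \<open>d \<ge> 2\<close> by (simp add: z_def)
  then have "z 0 \<noteq> 0" by fastforce
  then have "z 0 * z 0 > 0" unfolding zero_less_mult_iff by linarith
  then have "q > 0" unfolding q_def of_int_0_less_iff using \<open>d \<ge> 2\<close> by (intro sum_pos2[of _ 0]) auto
  have nz': "complex_of_real q \<noteq> 0" "complex_of_nat n \<noteq> 0" using \<open>q > 0\<close> \<open>d \<ge> 2\<close> by (auto simp: n_def)
  define Q where "Q i j = (\<Sum>a<m. v a i * cnj (v a j)) + (\<Sum>a<m. cnj (v a i) * v a j)" for i j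
  have compl: "Q i j + 1 / of_nat n + Z i * Z j / of_real q = (if i = j then 1 else 0)"
    if "i < n" "j < n" for i j
    using completeness_conjugate_pairs[OF nm skew _ on eig v1 vZ Zr Z0 qZ \<open>q > 0\<close> that] \<open>c > 0\<close>
    by (simp add: Q_def)
  have eigc: "(\<Sum>j<n. A i j * cnj (v a j)) = - (\<i> * c * cnj (v a i))" if "a < m" "i < n" for a i
    using arg_cong[OF eig[OF that], of cnj] by (simp add: A_def)
  \<comment> \<open>Expansion of an arbitrary f in the orthogonal basis; T is determined below by
    applying this to Tz and to the rows of T.\<close>
  have expand: "f i = (\<Sum>a<m. v a i * (\<Sum>j<n. f j * cnj (v a j))) + (\<Sum>a<m. cnj (v a i) * (\<Sum>j<n. f j * v a j))
      + (\<Sum>j<n. f j) / of_nat n + Z i * (\<Sum>j<n. f j * Z j) / of_real q" if "i < n" for f i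
  proof -
    have "f i = (\<Sum>j<n. f j * (if i = j then 1 else 0))"
      using that by (simp add: if_distrib[of "\<lambda>x. _ * x"] cong: if_cong)
    also have "\<dots> = (\<Sum>j<n. f j * (Q i j + 1 / of_nat n + Z i * Z j / of_real q))"
      using compl[OF that] by (intro sum.cong refl) simp
    also have "\<dots> = (\<Sum>j<n. f j * (\<Sum>a<m. v a i * cnj (v a j))) + (\<Sum>j<n. f j * (\<Sum>a<m. cnj (v a i) * v a j))
      + (\<Sum>j<n. f j) / of_nat n + Z i * (\<Sum>j<n. f j * Z j) / of_real q"
      by (simp add: Q_def distrib_left sum.distrib sum_divide_distrib sum_distrib_left mult_ac)
    also have "(\<Sum>j<n. f j * (\<Sum>a<m. v a i * cnj (v a j))) = (\<Sum>a<m. v a i * (\<Sum>j<n. f j * cnj (v a j)))"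
      unfolding sum_distrib_left mult.left_commute[of "f _"] by (rule sum.swap)
    also have "(\<Sum>j<n. f j * (\<Sum>a<m. cnj (v a i) * v a j)) = (\<Sum>a<m. cnj (v a i) * (\<Sum>j<n. f j * v a j))"
      unfolding sum_distrib_left mult.left_commute[of "f _"] by (rule sum.swap)
    finally show ?thesis .
  qed
  \<comment> \<open>Tz is orthogonal to z by skewness and to all eigenvectors because z is, so it is
    a multiple of 1. Its pairing with 1 is -q, which fixes the factor.\<close>
  have AZ: "(\<Sum>h<n. A i h * Z h) = - (q / n)" if "i < n" for i
  proof -
    define f where "f g = (\<Sum>h<n. A g h * Z h)" for g
    have fs: "(\<Sum>g<n. f g * u g) = - (\<Sum>h<n. (\<Sum>g<n. A h g * u g) * Z h)" for u
      using swap[of u Z] by (simp add: f_def mult.commute)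
    have 1: "(\<Sum>g<n. f g * v a g) = 0" if "a < m" for a
    proof -
      have "(\<Sum>g<n. f g * v a g) = - (\<Sum>h<n. \<i> * c * (Z h * v a h))"
        unfolding fs using eig[OF that] by (simp add: mult_ac)
      then show ?thesis unfolding sum_distrib_left[symmetric] vZ[OF that] by simp
    qed
    have 2: "(\<Sum>g<n. f g * cnj (v a g)) = 0" if "a < m" for a
    proof -
      have "(\<Sum>g<n. f g * cnj (v a g)) = cnj (\<Sum>g<n. f g * v a g)"
        by (simp add: f_def A_def Zr)
      then show ?thesis using 1[OF that] by simp
    qed
    have 3: "(\<Sum>g<n. f g) = - of_real q"
      using fs[of "\<lambda>_. 1"] by (simp add: qZ flip: Z)
    have "(\<Sum>g<n. f g * Z g) = - (\<Sum>g<n. f g * Z g)" using fs[of Z] by (simp add: f_def)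
    then have 4: "(\<Sum>g<n. f g * Z g) = 0" by (simp add: eq_neg_iff_add_eq_0)
    show ?thesis using expand[OF that, of f] 1 2 3 4 by (simp add: f_def)
  qed
  have G: "(\<Sum>h<n. A i h * A j h) = (if i = j then c * c else 0) + (q / n - c * c) * (1 / n + Z i * Z j / q)"
    if ij: "i < n" "j < n" for i j
  proof -
    define B where "B h = (\<Sum>a<m. v a h * - (\<i> * c * cnj (v a j)))" for h
    define C where "C h = (\<Sum>a<m. cnj (v a h) * (\<i> * c * v a j))" for h
    \<comment> \<open>Row j of T in the basis: its pairings with the conjugates, the eigenvectors, 1
      and z are -i c \<open>cnj (v a j)\<close>, i c \<open>v a j\<close>, \<open>Z j\<close> and
      -q/n.\<close>
    have "A j h = B h + C h + Z j / of_nat n + Z h * (- complex_of_real (q / n) / of_real q)" if "h < n" for h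
      using expand[OF that, of "A j"] eig[OF _ ij(2)] eigc[OF _ ij(2)] AZ[OF ij(2)]
      by (simp add: B_def C_def Z)
    then have "(\<Sum>h<n. A i h * A j h) =
        (\<Sum>h<n. A i h * (B h + C h + Z j / of_nat n + Z h * (- complex_of_real (q / n) / of_real q)))"
      by (intro sum.cong refl arg_cong2[where f = "(*)"]) simp
    also have "\<dots> = (\<Sum>h<n. A i h * B h) + (\<Sum>h<n. A i h * C h)
        + (\<Sum>h<n. A i h) * (Z j / of_nat n) + (\<Sum>h<n. A i h * Z h) * (- complex_of_real (q / n) / of_real q)"
      unfolding sum_distrib_right sum.distrib[symmetric]
      by (intro sum.cong refl) (simp only: distrib_left mult.assoc)
    also have "(\<Sum>h<n. A i h * B h) = (\<Sum>h<n. A i h * (\<Sum>a<m. v a h * - (\<i> * c * cnj (v a j))))"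
      by (simp only: B_def)
    also have "(\<Sum>h<n. A i h * C h) = (\<Sum>h<n. A i h * (\<Sum>a<m. cnj (v a h) * (\<i> * c * v a j)))"
      by (simp only: C_def)
    also have "(\<Sum>h<n. A i h * (\<Sum>a<m. v a h * - (\<i> * c * cnj (v a j)))) =
        (\<Sum>a<m. (\<Sum>h<n. A i h * v a h) * - (\<i> * c * cnj (v a j)))"
      unfolding sum_distrib_left sum_distrib_right mult.assoc by (rule sum.swap)
    also have "\<dots> = c * c * (\<Sum>a<m. v a i * cnj (v a j))"
      using eig ij by (simp add: sum_distrib_left mult_ac)
    also have "(\<Sum>h<n. A i h * (\<Sum>a<m. cnj (v a h) * (\<i> * c * v a j))) =
        (\<Sum>a<m. (\<Sum>h<n. A i h * cnj (v a h)) * (\<i> * c * v a j))"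
      unfolding sum_distrib_left sum_distrib_right mult.assoc by (rule sum.swap)
    also have "\<dots> = c * c * (\<Sum>a<m. cnj (v a i) * v a j)"
      using eigc ij by (simp add: sum_distrib_left mult_ac)
    also have "c * c * (\<Sum>a<m. v a i * cnj (v a j)) + c * c * (\<Sum>a<m. cnj (v a i) * v a j) = c * c * Q i j"
      by (simp add: Q_def distrib_left)
    also have "Q i j = (if i = j then 1 else 0) - 1 / n - Z i * Z j / q"
      using compl[OF ij] by (simp add: algebra_simps)
    also have "(\<Sum>h<n. A i h * Z h) * (- complex_of_real (q / n) / of_real q) = q / n * (1 / n)"
      unfolding AZ[OF ij(1)] using nz' by simp
    also have "(\<Sum>h<n. A i h) * (Z j / of_nat n) = q / n * (Z i * Z j / q)"
      unfolding Z[symmetric] using nz' by simp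
    finally show ?thesis by (simp add: algebra_simps)
  qed
  have fin: "real_of_int (\<Sum>h<2*d. tsgn E i h * tsgn E j h) =
    (if i = j then c\<^sup>2 else 0) + (q / (2 * real d) - c\<^sup>2) * (1 / (2 * real d) + of_int (z i) * of_int (z j) / q)" if "i < 2*d" "j < 2*d" for i j
  proof -
    have "complex_of_real (real_of_int (\<Sum>h<2*d. tsgn E i h * tsgn E j h)) =
      complex_of_real ((if i = j then c\<^sup>2 else 0) + (q / (2 * real d) - c\<^sup>2) * (1 / (2 * real d) + of_int (z i) * of_int (z j) / q))"
      using G[of i j] that by (simp add: A_def Z_def n_def power2_eq_square)
    then show ?thesis by (simp only: of_real_eq_iff)
  qed
  show ?thesis
    by (intro exI[of _ c] conjI allI impI) (fact \<open>c > 0\<close>, simp add: fin del: of_int_sum)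
qed

text \<open>Beyond the row formula, the issue is integrality: c^2 and the block constant start as
  real numbers and become integers because they are recovered from entries of the integer matrix T
  T^T.\<close>

lemma gram_representation_imp_block_gram:
  assumes T: "tournament {..<2*d} E" and "odd d" "d \<ge> 3" "b > 0" and R: "gram_representation d E a b x"
  shows "\<exists>\<epsilon> k l. k > 0 \<and> l \<noteq> 0 \<and> block_gram d E \<epsilon> k l"
proof -
  define z where "z i = (\<Sum>j<2*d. tsgn E i j)" for i
  define q where "q = real_of_int (\<Sum>i<2*d. z i * z i)"
  define G where "G i j = (\<Sum>h<2*d. tsgn E i h * tsgn E j h)" for i j
  have "d \<ge> 2" using \<open>d \<ge> 3\<close> by simp
  obtain c where "c > 0" and G: "\<forall>i<2*d. \<forall>j<2*d. real_of_int (\<Sum>h<2*d. tsgn E i h * tsgn E j h) =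
    (if i = j then c\<^sup>2 else 0) + (q / (2 * real d) - c\<^sup>2) * (1 / (2 * real d) + of_int (z i) * of_int (z j) / q)"
    using gram_representation_imp_row_formula[OF T \<open>d \<ge> 2\<close> \<open>b > 0\<close> R z_def q_def] by (elim exE conjE) (rule that)
  have G: "real_of_int (G i j) = (if i = j then c\<^sup>2 else 0) + (q / (2 * real d) - c\<^sup>2) * (1 / (2 * real d) + of_int (z i) * of_int (z j) / q)"
    if "i < 2*d" "j < 2*d" for i j
    using G that unfolding G_def by (simp del: of_int_sum)
  \<comment> \<open>The gap between the eigenvalue q/n on the span of 1 and z and the eigenvalue c^2
    on its complement; it will be d times l.\<close>
  define g where "g = q / (2*d) - c\<^sup>2"
  have lt: "0 < 2 * d" "1 < 2 * d" "2 < 2 * d" using \<open>d \<ge> 3\<close> by auto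
  have zodd: "odd (z i)" if "i < 2*d" for i
    using tsgn_row_sum_parity[OF T, of i] \<open>d \<ge> 3\<close> that by (simp add: z_def)
  then have znz: "z i \<noteq> 0" if "i < 2*d" for i using that by fastforce
  \<comment> \<open>Without a gap the rows of T would be pairwise orthogonal, and three of them
    would force 4 to divide 2d - 4, impossible for odd d.\<close>
  have "g \<noteq> 0"
  proof
    assume "g = 0"
    then have "G i j = 0" if "i < 2*d" "j < 2*d" "i \<noteq> j" for i j
      using G[OF that(1,2)] that(3) by (simp add: g_def)
    then have "G 0 1 = 0" "G 0 2 = 0" "G 1 2 = 0" using lt by simp_all
    moreover have "4 dvd int (card {..<2*d}) - 4 + G 0 1 + G 0 2 + G 1 2"
      unfolding G_def using lt by (intro tsgn_gram_mod4[OF T]) simp_all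
    ultimately have "4 dvd 2 * int d - 4" by simp
    then show False using \<open>odd d\<close> by presburger
  qed
  have "z 0 * z 0 > 0" using znz[OF lt(1)] unfolding zero_less_mult_iff by linarith
  then have "q > 0" unfolding q_def of_int_0_less_iff using lt by (intro sum_pos2[of _ 0]) auto
  have zsq: "z i * z i = z 0 * z 0" if "i < 2*d" for i
  proof -
    have "G i i = G 0 0" unfolding G_def using tsgn_row_norm[OF T, of i] tsgn_row_norm[OF T, of 0] that lt by simp
    moreover have "real_of_int (G i i) = c\<^sup>2 + g * (1 / (2 * real d) + of_int (z i) * of_int (z i) / q)"
      "real_of_int (G 0 0) = c\<^sup>2 + g * (1 / (2 * real d) + of_int (z 0) * of_int (z 0) / q)"
      using G[OF that that] G[OF lt(1) lt(1)] by (simp_all add: g_def)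
    ultimately have "g * (1 / (2 * real d) + of_int (z i) * of_int (z i) / q) =
        g * (1 / (2 * real d) + of_int (z 0) * of_int (z 0) / q)" by linarith
    then have "real_of_int (z i * z i) = real_of_int (z 0 * z 0)"
      using \<open>g \<noteq> 0\<close> \<open>q > 0\<close> by auto
    then show ?thesis by (simp only: of_int_eq_iff)
  qed
  define s where "s = \<bar>z 0\<bar>"
  define \<epsilon> where "\<epsilon> i = sgn (z i)" for i
  have "s > 0" using znz[OF lt(1)] by (simp add: s_def)
  have ze: "z i = \<epsilon> i * s" if "i < 2*d" for i
  proof -
    have "\<bar>z i\<bar> = s" using zsq[OF that] unfolding s_def by (metis abs_mult_self_eq abs_ge_zero power2_eq_square power2_eq_imp_eq)
    then show ?thesis unfolding \<epsilon>_def by (metis sgn_mult_abs)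
  qed
  have e1: "\<epsilon> i = 1 \<or> \<epsilon> i = - 1" if "i < 2*d" for i
    using znz[OF that] by (simp add: \<epsilon>_def sgn_if)
  have q: "q = 2 * d * (s * s)"
  proof -
    have "(\<Sum>i<2*d. z i * z i) = (\<Sum>i<2*d. z 0 * z 0)" by (intro sum.cong refl zsq) simp
    then show ?thesis by (simp add: q_def s_def flip: of_int_mult)
  qed
  have G': "real_of_int (G i j) = (if i = j then c\<^sup>2 else 0) + (if \<epsilon> i = \<epsilon> j then g / d else 0)"
    if "i < 2*d" "j < 2*d" for i j
  proof -
    have "real_of_int (z i * z j) / q = \<epsilon> i * \<epsilon> j / (2 * d)"
      unfolding q ze[OF that(1)] ze[OF that(2)] using \<open>s > 0\<close> lt by (simp add: field_simps)
    then have "real_of_int (G i j) = (if i = j then c\<^sup>2 else 0) + g * (1 / (2*d) + \<epsilon> i * \<epsilon> j / (2 * d))"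
      using G[OF that] by (simp add: g_def)
    then show ?thesis using e1[OF that(1)] e1[OF that(2)] lt by (auto simp: field_simps)
  qed
  \<comment> \<open>Two of three signs agree; the corresponding off-diagonal entry exhibits g / d as
    an integer.\<close>
  have "\<exists>i<2*d. \<exists>j<2*d. i \<noteq> j \<and> \<epsilon> i = \<epsilon> j"
    using e1[OF lt(1)] e1[OF lt(2)] e1[OF lt(3)] lt by (metis zero_neq_one zero_neq_numeral one_eq_numeral_iff num.distinct(1))
  then obtain i j where ij: "i < 2*d" "j < 2*d" "i \<noteq> j" "\<epsilon> i = \<epsilon> j" by blast
  define l where "l = G i j"
  have l: "g / d = of_int l" using G'[OF ij(1,2)] ij(3,4) by (simp add: l_def)
  define k where "k = G 0 0 - l"
  have k: "c\<^sup>2 = of_int k" using G'[OF lt(1) lt(1)] l by (simp add: k_def)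
  have "k > 0" using \<open>c > 0\<close> k by (metis of_int_0_less_iff zero_less_power)
  moreover have "l \<noteq> 0" using l \<open>g \<noteq> 0\<close> lt by auto
  moreover have "block_gram d E \<epsilon> k l"
    unfolding block_gram_def
  proof (intro conjI allI impI)
    show "(\<Sum>i<2*d. \<epsilon> i) = 0"
    proof -
      have "(\<Sum>i<2*d. 1 * (\<Sum>j<2*d. tsgn E i j * 1)) = - (\<Sum>j<2*d. (\<Sum>i<2*d. tsgn E j i * 1) * 1)"
        by (rule skew_sum_swap, rule tsgn_skew[OF T]) simp_all
      then have "(\<Sum>i<2*d. z i) = 0" by (simp add: z_def)
      then show ?thesis using ze \<open>s > 0\<close> by (simp flip: sum_distrib_right)
    qed
    show "(\<Sum>h<2*d. tsgn E i h * tsgn E j h) = (if i = j then k else 0) + (if \<epsilon> i = \<epsilon> j then l else 0)"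
      if "i < 2*d" "j < 2*d" for i j
    proof -
      have "real_of_int (G i j) = real_of_int ((if i = j then k else 0) + (if \<epsilon> i = \<epsilon> j then l else 0))"
        using G'[OF that] k l by simp
      then show ?thesis unfolding of_int_eq_iff G_def .
    qed
  qed (use e1 in auto)
  ultimately show ?thesis by blast
qed

subsection \<open>Codes and Gram representations\<close>

lemma cinner_sum:
  assumes "x \<in> carrier_vec d" "y \<in> carrier_vec d"
  shows "cinner x y = (\<Sum>h<d. cnj (x $ h) * y $ h)"
  using assms by (simp add: cinner_def scalar_prod_def atLeast0LessThan conjugate_complex_def)

lemma cinner_swap:
  assumes "x \<in> carrier_vec d" "y \<in> carrier_vec d"
  shows "cinner y x = cnj (cinner x y)"
  by (simp add: cinner_sum[OF assms] cinner_sum[OF assms(2,1)] mult.commute)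

text \<open>Exchanging the two vectors conjugates their angle, so a non-real angle brings its
  conjugate, and cardinality 2 leaves no other. Exactly one of the two has positive imaginary part,
  so the \<open>THE\<close> in \<open>code_alpha\<close> is well defined.\<close>

lemma complex_2code_angles:
  assumes X: "complex_2code d X"
  obtains \<alpha> where "Im \<alpha> > 0" "angle_set X = {\<alpha>, cnj \<alpha>}" "code_alpha X = \<alpha>"
proof -
  from X obtain w where w: "w \<in> angle_set X" "w \<notin> \<real>" and c: "card (angle_set X) = 2"
    and XO: "X \<subseteq> Omega d" unfolding complex_2code_def by blast
  from w(1) obtain x y where xy: "w = cinner x y" "x \<in> X" "y \<in> X" "x \<noteq> y"
    unfolding angle_set_def by blast
  have "x \<in> carrier_vec d" "y \<in> carrier_vec d" using xy XO by (auto simp: Omega_def)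
  then have "cnj w = cinner y x" unfolding xy(1) by (rule cinner_swap[symmetric])
  then have cw: "cnj w \<in> angle_set X" using xy unfolding angle_set_def by blast
  have ne: "cnj w \<noteq> w" using w(2) Reals_cnj_iff by blast
  have fin: "finite (angle_set X)" using c card.infinite by fastforce
  have eq: "angle_set X = {w, cnj w}"
    using w(1) cw ne c by (intro card_seteq[OF fin, symmetric]) auto
  have "Im w \<noteq> 0" using w(2) complex_is_Real_iff by blast
  define \<alpha> where "\<alpha> = (if Im w > 0 then w else cnj w)"
  have 1: "Im \<alpha> > 0" using \<open>Im w \<noteq> 0\<close> by (auto simp: \<alpha>_def)
  have 2: "angle_set X = {\<alpha>, cnj \<alpha>}" using eq by (auto simp: \<alpha>_def)
  have "code_alpha X = \<alpha>"
    unfolding code_alpha_def 2 using 1 by (intro the_equality) auto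
  then show ?thesis using that 1 2 by blast
qed

lemma code_imp_gram_representation:
  assumes T: "tournament {..<2*d} E" and X: "complex_2code d X"
    and iso: "tournament_iso {..<2*d} E X (code_tournament X)"
  shows "\<exists>a b x. b > 0 \<and> gram_representation d E a b x"
proof -
  obtain \<alpha> where \<alpha>: "Im \<alpha> > 0" "angle_set X = {\<alpha>, cnj \<alpha>}" "code_alpha X = \<alpha>"
    using complex_2code_angles[OF X] by blast
  from iso obtain f where f: "bij_betw f {..<2*d} X"
    and fE: "\<And>i j. i < 2*d \<Longrightarrow> j < 2*d \<Longrightarrow> E i j \<longleftrightarrow> code_tournament X (f i) (f j)"
    unfolding tournament_iso_def by auto
  have fX: "f i \<in> X" if "i < 2*d" for i using f that by (auto simp: bij_betw_def)
  have XO: "X \<subseteq> Omega d" using X unfolding complex_2code_def by blast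
  have car: "f i \<in> carrier_vec d" and unit: "cinner (f i) (f i) = 1" if "i < 2*d" for i
    using XO fX[OF that] by (auto simp: Omega_def)
  have "gram_representation d E (Re \<alpha>) (Im \<alpha>) (\<lambda>i h. f i $ h)"
    unfolding gram_representation_def
  proof (intro allI impI)
    fix i j assume ij: "i < 2*d" "j < 2*d"
    have "(\<Sum>h<d. cnj (f i $ h) * f j $ h) = cinner (f i) (f j)"
      using cinner_sum[OF car[OF ij(1)] car[OF ij(2)]] ..
    also have "\<dots> = (if i = j then 1 else Re \<alpha> + \<i> * Im \<alpha> * of_int (tsgn E i j))"
    proof (cases "i = j")
      case True
      then show ?thesis using unit ij by simp
    next
      case False
      then have ne: "f i \<noteq> f j" using f ij by (auto simp: bij_betw_def inj_on_def)
      then have mem: "cinner (f i) (f j) = \<alpha> \<or> cinner (f i) (f j) = cnj \<alpha>"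
        using \<alpha>(2) fX ij unfolding angle_set_def by blast
      have E: "E i j \<longleftrightarrow> cinner (f i) (f j) = \<alpha>"
        using fE[OF ij] ne fX ij \<alpha>(3) by (simp add: code_tournament_def)
      have "tsgn E i j = 1 \<or> tsgn E i j = - 1"
        using tsgn_cases[OF T] ij False by simp
      then have "tsgn E i j = (if E i j then 1 else - 1)" by (auto simp: tsgn_def split: if_splits)
      then show ?thesis using E mem False complex_eq[of \<alpha>] complex_eq[of "cnj \<alpha>"] by auto
    qed
    finally show "(\<Sum>h<d. cnj (f i $ h) * f j $ h) =
      (if i = j then 1 else Re \<alpha> + \<i> * Im \<alpha> * of_int (tsgn E i j))" .
  qed
  then show ?thesis using \<alpha>(1) by blast
qed

text \<open>For b > 0 the off-diagonal entries differ from 1, which separates the vectors, and the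
  edge between vertices 0 and 1, read in both directions, shows that both angles occur.\<close>

lemma gram_representation_imp_code:
  assumes T: "tournament {..<2*d} E" and "d > 0" "b > 0" and R: "gram_representation d E a b x"
  shows "\<exists>X. complex_2code d X \<and> card X = 2*d \<and> tournament_iso {..<2*d} E X (code_tournament X)"
proof -
  define f where "f i = vec d (x i)" for i
  define X where "X = f ` {..<2*d}"
  define \<alpha> where "\<alpha> = Complex a b"
  have \<alpha>: "\<alpha> = a + \<i> * b" "cnj \<alpha> = a - \<i> * b" "Im \<alpha> > 0" "\<alpha> \<notin> \<real>" "\<alpha> \<noteq> 1" "cnj \<alpha> \<noteq> 1" "\<alpha> \<noteq> cnj \<alpha>"
    using \<open>b > 0\<close> by (auto simp: \<alpha>_def complex_eq_iff complex_is_Real_iff)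
  have car: "f i \<in> carrier_vec d" for i by (simp add: f_def)
  have inner: "cinner (f i) (f j) = (if i = j then 1 else a + \<i> * b * of_int (tsgn E i j))"
    if "i < 2*d" "j < 2*d" for i j
    using R that unfolding cinner_sum[OF car car] gram_representation_def by (simp add: f_def)
  have ne: "cinner (f i) (f j) = (if E i j then \<alpha> else cnj \<alpha>)" if "i < 2*d" "j < 2*d" "i \<noteq> j" for i j
  proof -
    have "tsgn E i j = 1 \<or> tsgn E i j = - 1"
      using tsgn_cases[OF T] that by simp
    then have "tsgn E i j = (if E i j then 1 else - 1)" by (auto simp: tsgn_def split: if_splits)
    then show ?thesis using inner[OF that(1,2)] that(3) \<alpha>(1,2) by simp
  qed
  have inj: "inj_on f {..<2*d}"
  proof (rule inj_onI, rule ccontr)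
    fix i j assume ij: "i \<in> {..<2*d}" "j \<in> {..<2*d}" "f i = f j" "i \<noteq> j"
    then have "cinner (f i) (f j) = 1" using inner[of i i] by simp
    then show False using ne[of i j] ij \<alpha>(5,6) by (simp split: if_splits)
  qed
  have angles: "angle_set X = {\<alpha>, cnj \<alpha>}"
  proof
    show "angle_set X \<subseteq> {\<alpha>, cnj \<alpha>}"
    proof
      fix w assume "w \<in> angle_set X"
      then obtain i j where "w = cinner (f i) (f j)" "i < 2*d" "j < 2*d" "f i \<noteq> f j"
        unfolding angle_set_def X_def by blast
      moreover from this have "i \<noteq> j" by blast
      ultimately show "w \<in> {\<alpha>, cnj \<alpha>}" using ne[of i j] by simp
    qed
    have lt: "0 < 2*d" "1 < 2*d" using \<open>d > 0\<close> by auto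
    have "f 0 \<noteq> f 1" using inj lt by (auto simp: inj_on_def)
    moreover have "f 0 \<in> X" "f 1 \<in> X" using lt by (simp_all add: X_def)
    ultimately have "cinner (f 0) (f 1) \<in> angle_set X" "cinner (f 1) (f 0) \<in> angle_set X"
      unfolding angle_set_def by (blast, metis (mono_tags, lifting) mem_Collect_eq)
    moreover have "E 1 0 \<longleftrightarrow> \<not> E 0 1" using tournament_edge[OF T, of 0 1] lt by simp
    ultimately show "{\<alpha>, cnj \<alpha>} \<subseteq> angle_set X"
      using ne[of 0 1] ne[of 1 0] lt by (auto split: if_splits)
  qed
  have alpha: "code_alpha X = \<alpha>"
    unfolding code_alpha_def angles using \<alpha>(3) by (intro the_equality) auto
  have "complex_2code d X"
    unfolding complex_2code_def angles
  proof (intro conjI)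
    show "X \<subseteq> Omega d" using car inner by (auto simp: X_def Omega_def)
  qed (use \<alpha> in \<open>auto simp: X_def\<close>)
  moreover have "card X = 2*d" using inj by (simp add: X_def card_image)
  moreover have "tournament_iso {..<2*d} E X (code_tournament X)"
    unfolding tournament_iso_def
  proof (intro exI[of _ f] conjI ballI)
    show "bij_betw f {..<2*d} X" using inj by (simp add: bij_betw_def X_def)
    fix i j assume ij: "i \<in> {..<2*d}" "j \<in> {..<2*d}"
    then have fX: "f i \<in> X" "f j \<in> X" by (simp_all add: X_def)
    show "E i j \<longleftrightarrow> code_tournament X (f i) (f j)"
    proof (cases "i = j")
      case True
      have "\<not> E i i" using T ij(1) unfolding tournament_def by blast
      then show ?thesis using True by (simp add: code_tournament_def)
    next
      case False
      then have "f i \<noteq> f j" using inj ij by (auto simp: inj_on_def)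
      then show ?thesis using ne[of i j] ij False fX alpha \<alpha>(7) by (simp add: code_tournament_def)
    qed
  qed
  ultimately show ?thesis by blast
qed

section \<open>Size of the sign classes and the only negative value of l\<close>

lemma block_gram_card_positive:
  assumes "block_gram d E \<epsilon> k l"
  shows "card {i. i < 2*d \<and> \<epsilon> i = 1} = d"
proof -
  have e: "\<forall>i<2*d. \<epsilon> i = 1 \<or> \<epsilon> i = - 1" and "(\<Sum>i<2*d. \<epsilon> i) = 0"
    using assms unfolding block_gram_def by blast+
  have "(\<Sum>i<2*d. \<epsilon> i) = (\<Sum>i<2*d. 2 * (if \<epsilon> i = 1 then 1 else 0) - 1)"
    using e by (intro sum.cong refl) force
  also have "\<dots> = 2 * (\<Sum>i<2*d. if \<epsilon> i = 1 then 1 else 0) - 2 * int d"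
    by (simp add: sum_subtractf sum_distrib_left)
  also have "(\<Sum>i<2*d. if \<epsilon> i = 1 then 1 else 0 :: int) = int (card {i. i < 2*d \<and> \<epsilon> i = 1})"
    by (simp add: sum.If_cases Int_def lessThan_def)
  finally show ?thesis using \<open>(\<Sum>i<2*d. \<epsilon> i) = 0\<close> by simp
qed

text \<open>From p^2 = k + ld and k + l = 2d - 1 one gets 2d - 1 + l(d - 1) >= 0, so l > -6 for d >=
  3. The congruence on three rows reads 4 | 2d - 4 + 3l, that is, l = 2 mod 4 for odd d.\<close>

lemma block_gram_negative:
  assumes T: "tournament {..<2*d} E" and B: "block_gram d E \<epsilon> k l"
    and "odd d" "d \<ge> 3" "l < 0"
  shows "l = - 2" "k = 2 * int d + 1"
proof -
  have "l \<noteq> 0" "d > 0" using assms by auto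
  obtain p where "odd p" "p * p = k + l * int d"
    by (rule block_gram_row_sums[OF T B \<open>l \<noteq> 0\<close> \<open>d > 0\<close>]) (rule that)
  have k: "k + l = 2 * int d - 1" by (rule block_gram_diagonal[OF T B \<open>d > 0\<close>])
  \<comment> \<open>A sign class has d >= 3 members, so three vertices can be taken from one class,
    where all pairwise Gram entries are l.\<close>
  obtain S where S: "S \<subseteq> {i. i < 2*d \<and> \<epsilon> i = 1}" "card S = 3"
    using obtain_subset_with_card_n[of 3 "{i. i < 2*d \<and> \<epsilon> i = 1}"] block_gram_card_positive[OF B] \<open>d \<ge> 3\<close>
    by metis
  then obtain x y z where xyz: "S = {x, y, z}" "x \<noteq> y" "x \<noteq> z" "y \<noteq> z"
    by (auto simp: card_3_iff)
  then have lt: "x < 2*d" "y < 2*d" "z < 2*d" and e: "\<epsilon> x = 1" "\<epsilon> y = 1" "\<epsilon> z = 1" using S(1) by auto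
  have G: "(\<Sum>h<2*d. tsgn E i h * tsgn E j h) = l" if "i < 2*d" "j < 2*d" "i \<noteq> j" "\<epsilon> i = \<epsilon> j" for i j
    using B that by (simp add: block_gram_def)
  have "4 dvd int (card {..<2*d}) - 4 + (\<Sum>h<2*d. tsgn E x h * tsgn E y h)
      + (\<Sum>h<2*d. tsgn E x h * tsgn E z h) + (\<Sum>h<2*d. tsgn E y h * tsgn E z h)"
    using lt xyz by (intro tsgn_gram_mod4[OF T]) auto
  then have mod: "4 dvd 2 * int d - 4 + l + l + l"
    using G[of x y] G[of x z] G[of y z] lt xyz(2-4) e by simp
  have "0 \<le> k + l * int d" using \<open>p * p = k + l * int d\<close> by (metis zero_le_square)
  have "l > - 6"
  proof (rule ccontr)
    assume "\<not> ?thesis"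
    then have "l * (int d - 1) \<le> - 6 * (int d - 1)" using \<open>d \<ge> 3\<close> by (intro mult_right_mono) auto
    then have "k + l * int d < 0" using k \<open>d \<ge> 3\<close> by (simp add: algebra_simps)
    then show False using \<open>0 \<le> k + l * int d\<close> by simp
  qed
  then show "l = - 2" using mod \<open>l < 0\<close> \<open>odd d\<close> by presburger
  then show "k = 2 * int d + 1" using k by simp
qed

subsection \<open>Permutation similarity\<close>

text \<open>Qualified: \<open>Determinant\<close> shadows \<open>adj_mat\<close> by the adjugate.\<close>

lemma seidel_square_entry:
  assumes T: "tournament {..<n} E" and ij: "i < n" "j < n"
  shows "(seidel_mat n E * seidel_mat n E) $$ (i, j) = of_int (\<Sum>h<n. tsgn E i h * tsgn E j h)"
proof -
  have S: "seidel_mat n E $$ (i, j) = \<i> * of_int (tsgn E i j)" if "i < n" "j < n" for i j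
  proof (cases "i = j")
    case True
    then show ?thesis using that tsgn_self[OF T, of j] by (simp add: seidel_mat_def Defs.adj_mat_def)
  next
    case False
    then show ?thesis using tournament_edge[OF T, of i j] that
      by (simp add: seidel_mat_def Defs.adj_mat_def tsgn_def)
  qed
  have "(seidel_mat n E * seidel_mat n E) $$ (i, j) = (\<Sum>h<n. seidel_mat n E $$ (i, h) * seidel_mat n E $$ (h, j))"
    using ij by (simp add: seidel_mat_def Defs.adj_mat_def scalar_prod_def atLeast0LessThan)
  also have "\<dots> = (\<Sum>h<n. of_int (tsgn E i h * tsgn E j h))"
  proof (intro sum.cong refl)
    fix h assume "h \<in> {..<n}"
    then have h: "h < n" by simp
    have skew: "tsgn E h j = - tsgn E j h" using tsgn_skew[OF T, of h j] h ij by simp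
    \<comment> \<open>The sign of i * i cancels the one from skewness, so S^2 = T T^T.\<close>
    have "seidel_mat n E $$ (i, h) * seidel_mat n E $$ (h, j) = (\<i> * \<i>) * of_int (tsgn E i h * tsgn E h j)"
      unfolding S[OF ij(1) h] S[OF h ij(2)] by (simp only: of_int_mult mult_ac)
    then show "seidel_mat n E $$ (i, h) * seidel_mat n E $$ (h, j) = of_int (tsgn E i h * tsgn E j h)"
      by (simp add: skew)
  qed
  finally show ?thesis by simp
qed

text \<open>Row i of P selects coordinate \<open>\<sigma> i\<close>, so conjugation by P only
  reindexes entries; from here on the permutation is used in place of the matrix products.\<close>

lemma perm_similar_iff:
  assumes M: "M \<in> carrier_mat n n"
  shows "perm_similar n M N \<longleftrightarrow> (\<exists>\<sigma>. \<sigma> permutes {..<n} \<and> N = mat n n (\<lambda>(i, j). M $$ (\<sigma> i, \<sigma> j)))"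
proof -
  have *: "P * M * P\<^sup>T = mat n n (\<lambda>(i, j). M $$ (\<sigma> i, \<sigma> j))"
    if \<sigma>: "\<sigma> permutes {..<n}" and P: "P = mat n n (\<lambda>(i, j). if \<sigma> i = j then 1 else 0)" for P \<sigma>
  proof (rule eq_matI)
    show "dim_row (P * M * P\<^sup>T) = dim_row (mat n n (\<lambda>(i, j). M $$ (\<sigma> i, \<sigma> j)))"
      "dim_col (P * M * P\<^sup>T) = dim_col (mat n n (\<lambda>(i, j). M $$ (\<sigma> i, \<sigma> j)))" by (simp_all add: P)
    fix i j assume "i < dim_row (mat n n (\<lambda>(i, j). M $$ (\<sigma> i, \<sigma> j)))" "j < dim_col (mat n n (\<lambda>(i, j). M $$ (\<sigma> i, \<sigma> j)))"
    then have ij: "i < n" "j < n" by simp_all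
    have s: "\<sigma> i < n" if "i < n" for i using permutes_in_image[OF \<sigma>, of i] that by simp
    have PM: "(P * M) $$ (i, h) = M $$ (\<sigma> i, h)" if "h < n" for h
    proof -
      have "(P * M) $$ (i, h) = (\<Sum>g<n. (if \<sigma> i = g then 1 else 0) * M $$ (g, h))"
        using that ij M by (simp add: P scalar_prod_def atLeast0LessThan)
      also have "\<dots> = (\<Sum>g<n. if \<sigma> i = g then M $$ (g, h) else 0)"
        by (intro sum.cong refl) simp
      finally show ?thesis using s[OF ij(1)] by simp
    qed
    have "(P * M * P\<^sup>T) $$ (i, j) = (\<Sum>h<n. (P * M) $$ (i, h) * P\<^sup>T $$ (h, j))"
      using ij M by (simp add: P scalar_prod_def atLeast0LessThan)
    also have "\<dots> = (\<Sum>h<n. if \<sigma> j = h then M $$ (\<sigma> i, h) else 0)"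
      using ij PM by (intro sum.cong refl) (simp add: P)
    also have "\<dots> = M $$ (\<sigma> i, \<sigma> j)" using s[OF ij(2)] by simp
    finally show "(P * M * P\<^sup>T) $$ (i, j) = mat n n (\<lambda>(i, j). M $$ (\<sigma> i, \<sigma> j)) $$ (i, j)" using ij by simp
  qed
  show ?thesis
    unfolding perm_similar_def permutation_mat_def using * by metis
qed

lemma sum_half_signs:
  fixes d :: nat
  shows "(\<Sum>i<2*d. if i < d then 1 else - 1 :: int) = 0"
proof -
  have "(\<Sum>i<d + d. if i < d then 1 else - 1 :: int) = (\<Sum>i<d. 1) + (\<Sum>i<d. - 1)"
    using sum.atLeastLessThan_concat[of 0 d "d + d" "\<lambda>i. if i < d then 1 else - 1 :: int", symmetric]
      sum.shift_bounds_nat_ivl[of "\<lambda>i. if i < d then 1 else - 1 :: int" 0 d d]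
    by (simp add: atLeast0LessThan)
  then show ?thesis by (simp add: mult_2)
qed

text \<open>The \<open>let\<close> is kept in the shape it has in the theorem so that the rule
  rewrites it as a whole; \<open>i < d \<longleftrightarrow> j < d\<close> expresses that both
  indices lie in the same block.\<close>

lemma block_mat_entry:
  assumes "i < 2*d" "j < 2*d"
  shows "(let B = of_nat k \<cdot>\<^sub>m 1\<^sub>m d + of_nat l \<cdot>\<^sub>m all_ones_mat d
          in four_block_mat B (0\<^sub>m d d) (0\<^sub>m d d) B) $$ (i, j) =
     of_int ((if i = j then int k else 0) + (if i < d \<longleftrightarrow> j < d then int l else 0))"
  using assms by (auto simp: Let_def all_ones_mat_def)

lemma block_mat_dim:
  "(let B = of_nat k \<cdot>\<^sub>m 1\<^sub>m d + of_nat l \<cdot>\<^sub>m all_ones_mat d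
    in four_block_mat B (0\<^sub>m d d) (0\<^sub>m d d) B) \<in> carrier_mat (2*d) (2*d)"
  by (auto simp: Let_def all_ones_mat_def)

lemma perm_similar_imp_block_gram:
  assumes T: "tournament {..<2*d} E"
    and P: "perm_similar (2*d) (seidel_mat (2*d) E * seidel_mat (2*d) E)
       (let B = of_nat k \<cdot>\<^sub>m 1\<^sub>m d + of_nat l \<cdot>\<^sub>m all_ones_mat d
        in four_block_mat B (0\<^sub>m d d) (0\<^sub>m d d) B)"
  shows "\<exists>\<epsilon>. block_gram d E \<epsilon> (int k) (int l)"
proof -
  have car: "seidel_mat (2*d) E * seidel_mat (2*d) E \<in> carrier_mat (2*d) (2*d)"
    by (intro carrier_matI) (simp_all add: seidel_mat_def Defs.adj_mat_def)
  let ?N = "let B = of_nat k \<cdot>\<^sub>m 1\<^sub>m d + of_nat l \<cdot>\<^sub>m all_ones_mat d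
        in four_block_mat B (0\<^sub>m d d) (0\<^sub>m d d) B"
  from P obtain \<sigma> where \<sigma>: "\<sigma> permutes {..<2*d}"
    and N: "?N = mat (2*d) (2*d) (\<lambda>(i, j). (seidel_mat (2*d) E * seidel_mat (2*d) E) $$ (\<sigma> i, \<sigma> j))"
    unfolding perm_similar_iff[OF car] by blast
  \<comment> \<open>\<open>\<sigma>\<close> sends block positions to vertices; the sign of a vertex
    is determined by its position, hence through the inverse.\<close>
  define \<tau> where "\<tau> = inv_into UNIV \<sigma>"
  have \<tau>: "\<tau> permutes {..<2*d}" unfolding \<tau>_def by (rule permutes_inv[OF \<sigma>])
  have st: "\<sigma> (\<tau> i) = i" for i unfolding \<tau>_def by (rule permutes_inverses(1)[OF \<sigma>])
  have lt: "\<tau> i < 2*d" if "i < 2*d" for i using permutes_in_image[OF \<tau>, of i] that by simp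
  define \<epsilon> where "\<epsilon> i = (if \<tau> i < d then 1 else - 1 :: int)" for i
  have "block_gram d E \<epsilon> (int k) (int l)"
    unfolding block_gram_def
  proof (intro conjI allI impI)
    have "(\<Sum>i<2*d. \<epsilon> i) = (\<Sum>i<2*d. if i < d then 1 else - 1)"
      unfolding \<epsilon>_def using sum.permute[OF \<tau>, of "\<lambda>i. if i < d then 1 else - 1 :: int"] by (simp add: o_def)
    then show "(\<Sum>i<2*d. \<epsilon> i) = 0" using sum_half_signs by simp
  next
    fix i j assume ij: "i < 2*d" "j < 2*d"
    have "of_int ((if \<tau> i = \<tau> j then int k else 0) + (if \<tau> i < d \<longleftrightarrow> \<tau> j < d then int l else 0)) = ?N $$ (\<tau> i, \<tau> j)"
      by (rule block_mat_entry[OF lt[OF ij(1)] lt[OF ij(2)], symmetric])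
    also have "\<dots> = (seidel_mat (2*d) E * seidel_mat (2*d) E) $$ (i, j)"
      unfolding N using lt ij by (simp add: st)
    also have "\<dots> = of_int (\<Sum>h<2*d. tsgn E i h * tsgn E j h)"
      by (rule seidel_square_entry[OF T ij])
    finally have "(\<Sum>h<2*d. tsgn E i h * tsgn E j h) =
        (if \<tau> i = \<tau> j then int k else 0) + (if \<tau> i < d \<longleftrightarrow> \<tau> j < d then int l else 0)"
      unfolding of_int_eq_iff ..
    moreover have "\<tau> i = \<tau> j \<longleftrightarrow> i = j" using st by metis
    ultimately show "(\<Sum>h<2*d. tsgn E i h * tsgn E j h) =
        (if i = j then int k else 0) + (if \<epsilon> i = \<epsilon> j then int l else 0)"
      by (simp add: \<epsilon>_def)
  qed (auto simp: \<epsilon>_def)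
  then show ?thesis by blast
qed

text \<open>Balanced signs make both classes of size d, so sorting the vertices by sign produces two
  blocks of equal size.\<close>

lemma block_gram_imp_perm_similar:
  assumes T: "tournament {..<2*d} E" and B: "block_gram d E \<epsilon> (int k) (int l)"
  shows "perm_similar (2*d) (seidel_mat (2*d) E * seidel_mat (2*d) E)
     (let B = of_nat k \<cdot>\<^sub>m 1\<^sub>m d + of_nat l \<cdot>\<^sub>m all_ones_mat d
      in four_block_mat B (0\<^sub>m d d) (0\<^sub>m d d) B)"
proof -
  have car: "seidel_mat (2*d) E * seidel_mat (2*d) E \<in> carrier_mat (2*d) (2*d)"
    by (intro carrier_matI) (simp_all add: seidel_mat_def Defs.adj_mat_def)
  let ?N = "let B = of_nat k \<cdot>\<^sub>m 1\<^sub>m d + of_nat l \<cdot>\<^sub>m all_ones_mat d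
        in four_block_mat B (0\<^sub>m d d) (0\<^sub>m d d) B"
  let ?P = "{i. i < 2*d \<and> \<epsilon> i = 1}"
  let ?M = "{i. i < 2*d \<and> \<epsilon> i = - 1}"
  have e: "\<epsilon> i = 1 \<or> \<epsilon> i = - 1" if "i < 2*d" for i using B that unfolding block_gram_def by blast
  have un: "?P \<union> ?M = {..<2*d}" using e by auto
  have disj: "?P \<inter> ?M = {}" by auto
  have cP: "card ?P = d" by (rule block_gram_card_positive[OF B])
  have "card ?P + card ?M = 2*d"
    using card_Un_disjoint[of ?P ?M] disj unfolding un by simp
  then have cM: "card ?M = card {d..<2*d}" using cP by simp
  obtain f where f: "bij_betw f {..<d} ?P"
    using finite_same_card_bij[of "{..<d}" ?P] cP by auto
  obtain g where g: "bij_betw g {d..<2*d} ?M"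
    using finite_same_card_bij[of "{d..<2*d}" ?M] cM by auto
  \<comment> \<open>The identity beyond 2d is what \<open>permutes\<close> demands outside the
    set.\<close>
  define \<sigma> where "\<sigma> i = (if i < d then f i else if i < 2*d then g i else i)" for i
  have "bij_betw \<sigma> {..<d} ?P" using f by (rule bij_betw_cong[THEN iffD1, rotated]) (simp add: \<sigma>_def)
  moreover have "bij_betw \<sigma> {d..<2*d} ?M" using g by (rule bij_betw_cong[THEN iffD1, rotated]) (simp add: \<sigma>_def)
  ultimately have "bij_betw \<sigma> ({..<d} \<union> {d..<2*d}) (?P \<union> ?M)" using disj by (rule bij_betw_combine)
  moreover have "{..<d} \<union> {d..<2*d} = {..<2*d}" by auto
  ultimately have bij: "bij_betw \<sigma> {..<2*d} {..<2*d}" using un by simp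
  have \<sigma>: "\<sigma> permutes {..<2*d}"
    by (rule bij_imp_permutes[OF bij]) (simp add: \<sigma>_def)
  have es: "\<epsilon> (\<sigma> i) = (if i < d then 1 else - 1)" if "i < 2*d" for i
    using f g that by (auto simp: \<sigma>_def bij_betw_def)
  have lt: "\<sigma> i < 2*d" if "i < 2*d" for i using permutes_in_image[OF \<sigma>, of i] that by simp
  have inj: "\<sigma> i = \<sigma> j \<longleftrightarrow> i = j" for i j using permutes_inj[OF \<sigma>] by (simp add: inj_eq)
  have "?N = mat (2*d) (2*d) (\<lambda>(i, j). (seidel_mat (2*d) E * seidel_mat (2*d) E) $$ (\<sigma> i, \<sigma> j))"
  proof (rule eq_matI)
    fix i j assume "i < dim_row (mat (2*d) (2*d) (\<lambda>(i, j). (seidel_mat (2*d) E * seidel_mat (2*d) E) $$ (\<sigma> i, \<sigma> j)))"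
      "j < dim_col (mat (2*d) (2*d) (\<lambda>(i, j). (seidel_mat (2*d) E * seidel_mat (2*d) E) $$ (\<sigma> i, \<sigma> j)))"
    then have ij: "i < 2*d" "j < 2*d" by simp_all
    have "(\<Sum>h<2*d. tsgn E (\<sigma> i) h * tsgn E (\<sigma> j) h) =
        (if i = j then int k else 0) + (if \<epsilon> (\<sigma> i) = \<epsilon> (\<sigma> j) then int l else 0)"
      using B lt[OF ij(1)] lt[OF ij(2)] unfolding block_gram_def inj[symmetric, of i j] by blast
    then have "?N $$ (i, j) = of_int (\<Sum>h<2*d. tsgn E (\<sigma> i) h * tsgn E (\<sigma> j) h)"
      unfolding block_mat_entry[OF ij] by (simp add: es ij)
    then show "?N $$ (i, j) = mat (2*d) (2*d) (\<lambda>(i, j). (seidel_mat (2*d) E * seidel_mat (2*d) E) $$ (\<sigma> i, \<sigma> j)) $$ (i, j)"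
      using seidel_square_entry[OF T lt[OF ij(1)] lt[OF ij(2)]] ij by simp
  qed (use block_mat_dim[of k d l] in auto)
  then show ?thesis unfolding perm_similar_iff[OF car] using \<sigma> by blast
qed

subsection \<open>Doubly regular tournaments\<close>

text \<open>Row sums of T = 2A - J + I; the final 1 is the diagonal correction.\<close>

lemma tsgn_row_sum:
  assumes T: "tournament V E" and x: "x \<in> V"
  shows "(\<Sum>y\<in>V. tsgn E x y) = 2 * int (card {y\<in>V. E x y}) - int (card V) + 1"
proof -
  have fin: "finite V" by (rule tournament_finite[OF T])
  have t: "tsgn E x y = 2 * (if E x y then 1 else 0) - 1 + (if x = y then 1 else 0)" if "y \<in> V" for y
  proof (cases "x = y")
    case True
    have "\<not> E x x" using T x unfolding tournament_def by blast
    then show ?thesis using True tsgn_self[OF T x] by simp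
  next
    case False
    then show ?thesis using tournament_edge[OF T x that] by (simp add: tsgn_def)
  qed
  have "(\<Sum>y\<in>V. tsgn E x y) = (\<Sum>y\<in>V. 2 * (if E x y then 1 else 0) - 1 + (if x = y then 1 else 0))"
    by (intro sum.cong refl t)
  also have "\<dots> = 2 * (\<Sum>y\<in>V. if E x y then 1 else 0) - int (card V) + 1"
    using fin x by (simp add: sum.distrib sum_subtractf sum_distrib_left)
  also have "(\<Sum>y\<in>V. if E x y then 1 else 0 :: int) = int (card {y\<in>V. E x y})"
    using fin by (simp add: sum.If_cases Int_def)
  finally show ?thesis .
qed

text \<open>Off the diagonal the entries are 2[E x u] - 1 and 2[E y u] - 1, whose product expands
  into the counts. The corrections at u = x and u = y cancel because exactly one of the two edges
  between x and y is present.\<close>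

lemma tsgn_gram_common_out:
  assumes T: "tournament V E" and xy: "x \<in> V" "y \<in> V" "x \<noteq> y"
  shows "(\<Sum>u\<in>V. tsgn E x u * tsgn E y u) = 4 * int (card {u\<in>V. E x u \<and> E y u})
     - 2 * int (card {u\<in>V. E x u}) - 2 * int (card {u\<in>V. E y u}) + int (card V)"
proof -
  have fin: "finite V" by (rule tournament_finite[OF T])
  let ?b = "\<lambda>Q. if Q then 1 else 0 :: int"
  have loop: "\<not> E x x" "\<not> E y y" using T xy unfolding tournament_def by blast+
  have t: "tsgn E x u * tsgn E y u = 4 * ?b (E x u \<and> E y u) - 2 * ?b (E x u) - 2 * ?b (E y u) + 1
      + (if x = u then 2 * ?b (E y x) - 1 else 0) + (if y = u then 2 * ?b (E x y) - 1 else 0)" if "u \<in> V" for u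
  proof -
    consider "u = x" | "u = y" | "x \<noteq> u" "y \<noteq> u" by blast
    then show ?thesis
    proof cases
      case 1
      then show ?thesis using loop xy tsgn_self[OF T xy(1)] by simp
    next
      case 2
      then show ?thesis using loop xy tsgn_self[OF T xy(2)] by simp
    next
      case 3
      then show ?thesis
        using tournament_edge[OF T xy(1) that] tournament_edge[OF T xy(2) that] by (simp add: tsgn_def)
    qed
  qed
  have c: "(\<Sum>u\<in>V. ?b (Q u)) = int (card {u\<in>V. Q u})" for Q
    using fin by (simp add: sum.If_cases Int_def)
  have "(\<Sum>u\<in>V. tsgn E x u * tsgn E y u) = (\<Sum>u\<in>V. 4 * ?b (E x u \<and> E y u) - 2 * ?b (E x u) - 2 * ?b (E y u) + 1
      + (if x = u then 2 * ?b (E y x) - 1 else 0) + (if y = u then 2 * ?b (E x y) - 1 else 0))"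
    by (intro sum.cong refl t)
  also have "\<dots> = 4 * (\<Sum>u\<in>V. ?b (E x u \<and> E y u)) - 2 * (\<Sum>u\<in>V. ?b (E x u)) - 2 * (\<Sum>u\<in>V. ?b (E y u))
      + int (card V) + ((2 * ?b (E y x) - 1) + (2 * ?b (E x y) - 1))"
    unfolding sum.distrib sum_subtractf sum_distrib_left[symmetric] using fin xy by simp
  also have "(2 * ?b (E y x) - 1) + (2 * ?b (E x y) - 1) = 0" using tournament_edge[OF T xy] by simp
  finally show ?thesis unfolding c using tournament_edge[OF T xy] by simp
qed

text \<open>Regularity makes all row sums of T equal, and skewness makes their total 0. The
  off-diagonal Gram entries are likewise a constant g; as T^T kills 1, each row of T T^T sums to 0,
  so (card V - 1)(1 + g) = 0.\<close>

lemma doubly_regular_tsgn: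
  assumes "doubly_regular V F" and card: "card V > 1"
  shows "\<And>x. x \<in> V \<Longrightarrow> (\<Sum>y\<in>V. tsgn F x y) = 0"
    and "\<And>x y. x \<in> V \<Longrightarrow> y \<in> V \<Longrightarrow> x \<noteq> y \<Longrightarrow> (\<Sum>u\<in>V. tsgn F x u * tsgn F y u) = - 1"
proof -
  note dr = assms(1)[unfolded doubly_regular_def]
  have T: "tournament V F" using dr ..
  obtain k where k: "\<forall>x\<in>V. card {y\<in>V. F x y} = k"
    using conjunct1[OF conjunct2[OF dr]] ..
  obtain m where m: "\<forall>x\<in>V. \<forall>y\<in>V. x \<noteq> y \<longrightarrow> card {z\<in>V. F x z \<and> F y z} = m"
    using conjunct2[OF conjunct2[OF dr]] ..
  have fin: "finite V" by (rule tournament_finite[OF T])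
  define r where "r = 2 * int k - int (card V) + 1"
  have r: "(\<Sum>y\<in>V. tsgn F x y) = r" if "x \<in> V" for x
    using tsgn_row_sum[OF T that] bspec[OF k that] by (simp add: r_def)
  have "(\<Sum>x\<in>V. \<Sum>y\<in>V. tsgn F x y) = (\<Sum>y\<in>V. \<Sum>x\<in>V. tsgn F x y)" by (rule sum.swap)
  also have "\<dots> = (\<Sum>y\<in>V. \<Sum>x\<in>V. - tsgn F y x)"
    by (intro sum.cong refl tsgn_skew[OF T])
  finally have "int (card V) * r = - (int (card V) * r)" using r by (simp add: sum_negf)
  then have "r = 0" using card by auto
  then show r0: "(\<Sum>y\<in>V. tsgn F x y) = 0" if "x \<in> V" for x using r[OF that] by simp
  define g where "g = 4 * int m - 4 * int k + int (card V)"
  have g: "(\<Sum>u\<in>V. tsgn F x u * tsgn F y u) = g" if "x \<in> V" "y \<in> V" "x \<noteq> y" for x y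
    using tsgn_gram_common_out[OF T that] k m that by (simp add: g_def)
  have "V \<noteq> {}" using card by auto
  then obtain x where x: "x \<in> V" by blast
  have "(\<Sum>y\<in>V. \<Sum>u\<in>V. tsgn F x u * tsgn F y u) = (\<Sum>u\<in>V. tsgn F x u * (\<Sum>y\<in>V. tsgn F y u))"
    unfolding sum_distrib_left by (rule sum.swap)
  also have "\<dots> = (\<Sum>u\<in>V. tsgn F x u * (\<Sum>y\<in>V. - tsgn F u y))"
    by (intro sum.cong refl arg_cong2[where f = "(*)"] tsgn_skew[OF T])
  also have "\<dots> = 0" using r0 by (simp add: sum_negf)
  finally have "0 = (\<Sum>y\<in>V. \<Sum>u\<in>V. tsgn F x u * tsgn F y u)" ..
  also have "\<dots> = (\<Sum>u\<in>V. tsgn F x u * tsgn F x u) + (\<Sum>y\<in>V - {x}. \<Sum>u\<in>V. tsgn F x u * tsgn F y u)"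
    by (rule sum.remove[OF fin x])
  also have "(\<Sum>y\<in>V - {x}. \<Sum>u\<in>V. tsgn F x u * tsgn F y u) = (\<Sum>y\<in>V - {x}. g)"
    using x by (intro sum.cong refl g) auto
  also have "(\<Sum>u\<in>V. tsgn F x u * tsgn F x u) = int (card V) - 1" by (rule tsgn_row_norm[OF T x])
  finally have "0 = int (card V) - 1 + int (card (V - {x})) * g" by simp
  moreover have "int (card (V - {x})) = int (card V) - 1" using x fin card by (simp add: of_nat_diff)
  ultimately have "(int (card V) - 1) * (1 + g) = 0" by (simp only: distrib_left mult_1_right)
  then have "g = - 1" using card by auto
  then show "(\<Sum>u\<in>V. tsgn F x u * tsgn F y u) = - 1" if "x \<in> V" "y \<in> V" "x \<noteq> y" for x y
    using g[OF that] by simp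
qed

text \<open>The full Gram matrix is (2d + 1)I - J. Deleting the column of v subtracts
  \<open>\<epsilon> i * \<epsilon> j\<close>, where \<open>\<epsilon>\<close> is the row of v, and
  turns -1 into -2 or 0. The signs are balanced because that row sums to 0.\<close>

lemma doubly_regular_deletion_imp_block_gram:
  fixes V :: "'a set"
  assumes V: "doubly_regular V F" "v \<in> V" and "d > 0"
    and iso: "tournament_iso {..<2*d} E (V - {v}) (delete_vertex V F v)"
  shows "\<exists>\<epsilon>. block_gram d E \<epsilon> (2 * int d + 1) (- 2)"
proof -
  have T: "tournament V F" using V(1) unfolding doubly_regular_def by blast
  have fin: "finite V" by (rule tournament_finite[OF T])
  from iso obtain f where f: "bij_betw f {..<2*d} (V - {v})"
    and fE: "\<And>i j. i < 2*d \<Longrightarrow> j < 2*d \<Longrightarrow> E i j \<longleftrightarrow> delete_vertex V F v (f i) (f j)"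
    unfolding tournament_iso_def by auto
  have "card (V - {v}) = 2*d" using bij_betw_same_card[OF f] by simp
  then have card: "card V = 2*d + 1" using V(2) fin by (metis Suc_eq_plus1 card_Suc_Diff1)
  then have "card V > 1" using \<open>d > 0\<close> by simp
  note dr = doubly_regular_tsgn[OF V(1) this]
  have fV: "f i \<in> V" "f i \<noteq> v" if "i < 2*d" for i using f that by (auto simp: bij_betw_def)
  have finj: "f i = f j \<longleftrightarrow> i = j" if "i < 2*d" "j < 2*d" for i j
    using f that by (auto simp: bij_betw_def inj_on_def)
  have E: "tsgn E i j = tsgn F (f i) (f j)" if "i < 2*d" "j < 2*d" for i j
    using fE[OF that] fE[OF that(2,1)] fV that by (simp add: tsgn_def delete_vertex_def)
  define \<epsilon> where "\<epsilon> i = tsgn F v (f i)" for i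
  have e: "\<epsilon> i = 1 \<or> \<epsilon> i = - 1" if "i < 2*d" for i
    using tsgn_cases[OF T V(2) fV(1)[OF that]] fV(2)[OF that] by (auto simp: \<epsilon>_def)
  have re: "(\<Sum>i<2*d. h (f i)) = (\<Sum>u\<in>V. h u) - h v" for h :: "'a \<Rightarrow> int"
    using sum.reindex_bij_betw[OF f, of h] sum.remove[OF fin V(2), of h] by simp
  have "block_gram d E \<epsilon> (2 * int d + 1) (- 2)"
    unfolding block_gram_def
  proof (intro conjI allI impI)
    show "(\<Sum>i<2*d. \<epsilon> i) = 0"
      unfolding \<epsilon>_def re by (simp add: dr(1)[OF V(2)] tsgn_self[OF T V(2)])
  next
    fix i j assume ij: "i < 2*d" "j < 2*d"
    have "(\<Sum>h<2*d. tsgn E i h * tsgn E j h) = (\<Sum>h<2*d. tsgn F (f i) (f h) * tsgn F (f j) (f h))"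
      using E ij by (intro sum.cong refl) simp
    also have "\<dots> = (\<Sum>u\<in>V. tsgn F (f i) u * tsgn F (f j) u) - tsgn F (f i) v * tsgn F (f j) v"
      by (rule re)
    also have "tsgn F (f i) v * tsgn F (f j) v = \<epsilon> i * \<epsilon> j"
      using tsgn_skew[OF T fV(1)[OF ij(1)] V(2)] tsgn_skew[OF T fV(1)[OF ij(2)] V(2)] by (simp add: \<epsilon>_def)
    also have "(\<Sum>u\<in>V. tsgn F (f i) u * tsgn F (f j) u) = (if i = j then 2 * int d + 1 else 0) - 1"
      using dr(2)[OF fV(1)[OF ij(1)] fV(1)[OF ij(2)]] finj[OF ij] tsgn_row_norm[OF T fV(1)[OF ij(1)]] card
      by auto
    finally show "(\<Sum>h<2*d. tsgn E i h * tsgn E j h) =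
        (if i = j then 2 * int d + 1 else 0) + (if \<epsilon> i = \<epsilon> j then - 2 else 0)"
      using e[OF ij(1)] e[OF ij(2)] by auto
  qed (use e in auto)
  then show ?thesis by blast
qed

text \<open>Here p^2 = k + ld = 1, so T1 = p \<open>\<epsilon>\<close> is a sign vector
  \<open>\<eta>\<close>. Bordering by it adds \<open>\<epsilon> x * \<epsilon> y\<close> to the Gram
  entries, which turns both -2 and 0 into -1, and the new row meets every old one in T
  \<open>\<eta>\<close> = -1. Constant degrees and common out-neighbour counts follow from the
  counting identities.\<close>

lemma block_gram_imp_doubly_regular_deletion:
  assumes T: "tournament {..<2*d} E" and B: "block_gram d E \<epsilon> (2 * int d + 1) (- 2)" and "d > 0"
  shows "\<exists>V F v. doubly_regular (V :: nat set) F \<and> v \<in> V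
    \<and> tournament_iso {..<2*d} E (V - {v}) (delete_vertex V F v)"
proof -
  define n where "n = 2 * d"
  obtain p where "odd p" and p: "p * p = 2 * int d + 1 + - 2 * int d"
    and T1: "\<And>i. i < 2*d \<Longrightarrow> (\<Sum>j<2*d. tsgn E i j) = p * \<epsilon> i"
    and Te: "\<And>i. i < 2*d \<Longrightarrow> (\<Sum>j<2*d. tsgn E i j * \<epsilon> j) = - p"
    by (rule block_gram_row_sums[OF T B _ \<open>d > 0\<close>]) (simp, rule that)
  define \<eta> where "\<eta> i = p * \<epsilon> i" for i
  have eps: "\<epsilon> i = 1 \<or> \<epsilon> i = - 1" if "i < n" for i using B that unfolding block_gram_def n_def by blast
  have pp: "p * p = 1" using p by simp
  then have "p = 1 \<or> p = - 1" by (simp add: square_eq_1_iff)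
  then have eta: "\<eta> i = 1 \<or> \<eta> i = - 1" if "i < n" for i using eps[OF that] by (auto simp: \<eta>_def)
  have eta_prod: "\<eta> i * \<eta> j = \<epsilon> i * \<epsilon> j" for i j
    using pp by (simp add: \<eta>_def mult_ac)
  have T1: "(\<Sum>j<n. tsgn E i j) = \<eta> i" if "i < n" for i using T1 that by (simp add: n_def \<eta>_def)
  have Te: "(\<Sum>j<n. tsgn E i j * \<eta> j) = - 1" if "i < n" for i
  proof -
    have "(\<Sum>j<n. tsgn E i j * \<eta> j) = p * (\<Sum>j<n. tsgn E i j * \<epsilon> j)"
      unfolding \<eta>_def sum_distrib_left by (intro sum.cong refl) (rule mult.left_commute)
    then show ?thesis using Te that pp by (simp add: n_def)
  qed
  have eta0: "(\<Sum>i<n. \<eta> i) = 0"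
    using B unfolding block_gram_def n_def \<eta>_def by (simp flip: sum_distrib_left)
  \<comment> \<open>The new row is \<open>\<eta>\<close> and the new column its negative, so that
    each old row sum, which was \<open>\<eta> x\<close>, becomes 0.\<close>
  define F where "F x y \<longleftrightarrow> (x < n \<and> y < n \<and> E x y) \<or> (x = n \<and> y < n \<and> \<eta> y = 1) \<or> (x < n \<and> y = n \<and> \<eta> x = - 1)" for x y
  define V where "V = {..<Suc n}"
  have Eirr: "\<not> E x x" for x using T unfolding tournament_def by blast
  have TF: "tournament V F"
    unfolding tournament_def
  proof (intro conjI allI impI ballI)
    fix x y assume "x \<in> V" "y \<in> V" "x \<noteq> y"
    then have "x < Suc n" "y < Suc n" "x \<noteq> y" by (simp_all add: V_def)
    then consider "x < n" "y < n" | "x = n" "y < n" | "x < n" "y = n" by linarith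
    then have "F x y \<longleftrightarrow> \<not> F y x"
    proof cases
      case 1
      then show ?thesis using tournament_edge[OF T, of x y] \<open>x \<noteq> y\<close> by (simp add: F_def n_def)
    next
      case 2
      then show ?thesis using eta[of y] by (auto simp: F_def)
    next
      case 3
      then show ?thesis using eta[of x] by (auto simp: F_def)
    qed
    then show "F x y \<or> F y x" "\<not> (F x y \<and> F y x)" by blast+
  qed (auto simp: V_def F_def Eirr)
  have t1: "tsgn F i j = tsgn E i j" if "i < n" "j < n" for i j
    using that by (simp add: tsgn_def F_def)
  have t2: "tsgn F n j = \<eta> j" "tsgn F j n = - \<eta> j" if "j < n" for j
    using that eta[OF that] by (auto simp: tsgn_def F_def)
  have t3: "tsgn F n n = 0" using tsgn_self[OF TF, of n] by (simp add: V_def)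
  have row: "(\<Sum>y\<in>V. tsgn F x y) = 0" if "x \<in> V" for x
  proof (cases "x = n")
    case True
    then show ?thesis using eta0 t2 t3 by (simp add: V_def)
  next
    case False
    then have "x < n" using that by (simp add: V_def)
    then show ?thesis using T1 t1 t2 by (simp add: V_def)
  qed
  have gram: "(\<Sum>u\<in>V. tsgn F x u * tsgn F y u) = - 1" if "x \<in> V" "y \<in> V" "x \<noteq> y" for x y
  proof -
    have new: "(\<Sum>u\<in>V. tsgn F n u * tsgn F y u) = - 1" if "y < n" for y
    proof -
      have "(\<Sum>u\<in>V. tsgn F n u * tsgn F y u) = (\<Sum>u<n. tsgn E y u * \<eta> u)"
        using that t1 t2 t3 by (simp add: V_def mult.commute)
      then show ?thesis using Te[OF that] by simp
    qed
    have "x < Suc n" "y < Suc n" using \<open>x \<in> V\<close> \<open>y \<in> V\<close> by (simp_all add: V_def)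
    then consider "x < n" "y < n" | "x = n" "y < n" | "x < n" "y = n"
      using \<open>x \<noteq> y\<close> by linarith
    then show ?thesis
    proof cases
      case 1
      have "(\<Sum>u\<in>V. tsgn F x u * tsgn F y u) = (\<Sum>u<n. tsgn E x u * tsgn E y u) + \<epsilon> x * \<epsilon> y"
        using 1 t1 t2 by (simp add: V_def eta_prod)
      moreover have "(\<Sum>u<n. tsgn E x u * tsgn E y u) = (if \<epsilon> x = \<epsilon> y then - 2 else 0)"
        using B 1 \<open>x \<noteq> y\<close> unfolding block_gram_def n_def by simp
      ultimately show ?thesis using eps[OF 1(1)] eps[OF 1(2)] by auto
    next
      case 2
      then show ?thesis using new by simp
    next
      case 3
      then show ?thesis using new[OF 3(1)] by (simp add: mult.commute)
    qed
  qed
  have out: "card {y\<in>V. F x y} = d" if "x \<in> V" for x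
    using tsgn_row_sum[OF TF that] row[OF that] by (simp add: V_def n_def)
  have common: "4 * int (card {u\<in>V. F x u \<and> F y u}) = 2 * int d - 2" if "x \<in> V" "y \<in> V" "x \<noteq> y" for x y
    using tsgn_gram_common_out[OF TF that] gram[OF that] out[OF that(1)] out[OF that(2)]
    by (simp add: V_def n_def)
  have "doubly_regular V F"
    unfolding doubly_regular_def
  proof (intro conjI)
    show "\<exists>k. \<forall>x\<in>V. card {y\<in>V. F x y} = k" using out by blast
    have "card {u\<in>V. F x u \<and> F y u} = (d - 1) div 2" if "x \<in> V" "y \<in> V" "x \<noteq> y" for x y
      using common[OF that] by linarith
    then show "\<exists>m. \<forall>x\<in>V. \<forall>y\<in>V. x \<noteq> y \<longrightarrow> card {z\<in>V. F x z \<and> F y z} = m" by blast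
  qed (rule TF)
  moreover have "n \<in> V" by (simp add: V_def)
  moreover have "V - {n} = {..<2*d}" by (auto simp: V_def n_def)
  moreover have "tournament_iso {..<2*d} E {..<2*d} (delete_vertex V F n)"
    unfolding tournament_iso_def
    by (intro exI[of _ id]) (auto simp: delete_vertex_def F_def V_def n_def)
  ultimately show ?thesis by (intro exI[of _ V] exI[of _ F] exI[of _ n]) simp
qed

theorem theorem4p8:
  fixes d :: nat and E :: "nat \<Rightarrow> nat \<Rightarrow> bool"
  assumes "odd d" and "d \<ge> 3"
    and "tournament {..<2*d} E"
  shows "(\<exists>X. complex_2code d X \<and> card X = 2*d
             \<and> tournament_iso {..<2*d} E X (code_tournament X))
    \<longleftrightarrow>
         ((\<exists>V F v. doubly_regular (V :: nat set) F \<and> v \<in> V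
             \<and> tournament_iso {..<2*d} E (V - {v}) (delete_vertex V F v))
          \<or> (\<exists>k l :: nat. k > 0 \<and> l > 0 \<and>
               perm_similar (2*d) (seidel_mat (2*d) E * seidel_mat (2*d) E)
                 (let B = of_nat k \<cdot>\<^sub>m 1\<^sub>m d + of_nat l \<cdot>\<^sub>m all_ones_mat d
                  in four_block_mat B (0\<^sub>m d d) (0\<^sub>m d d) B)))"
    (is "?code \<longleftrightarrow> ?del \<or> ?sim")
proof -
  note T = assms(3)
  have "d > 0" using \<open>d \<ge> 3\<close> by simp
  \<comment> \<open>The sign of l is left open here; the second equivalence splits it, positive l
    for \<open>?sim\<close> and negative l, hence -2, for \<open>?del\<close>.\<close>
  have "?code \<longleftrightarrow> (\<exists>\<epsilon> k l. k > 0 \<and> l \<noteq> 0 \<and> block_gram d E \<epsilon> k l)"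
  proof
    assume ?code
    then obtain a b x where "b > 0" "gram_representation d E a b x"
      using code_imp_gram_representation[OF T] by blast
    then show "\<exists>\<epsilon> k l. k > 0 \<and> l \<noteq> 0 \<and> block_gram d E \<epsilon> k l"
      using gram_representation_imp_block_gram[OF T assms(1,2)] by blast
  next
    assume "\<exists>\<epsilon> k l. k > 0 \<and> l \<noteq> 0 \<and> block_gram d E \<epsilon> k l"
    then obtain a b x where "b > 0" "gram_representation d E a b x"
      using block_gram_vectors[OF T _ _ _ \<open>d > 0\<close>] by blast
    then show ?code using gram_representation_imp_code[OF T \<open>d > 0\<close>] by blast
  qed
  also have "\<dots> \<longleftrightarrow> ?del \<or> ?sim"
  proof
    assume "\<exists>\<epsilon> k l. k > 0 \<and> l \<noteq> 0 \<and> block_gram d E \<epsilon> k l"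
    then obtain \<epsilon> k l where kl: "k > 0" "l \<noteq> 0" and B: "block_gram d E \<epsilon> k l" by blast
    show "?del \<or> ?sim"
    proof (cases "l > 0")
      case True
      then have "block_gram d E \<epsilon> (int (nat k)) (int (nat l))" using B kl by simp
      from block_gram_imp_perm_similar[OF T this] have ?sim
        using True kl(1) by (intro exI[of _ "nat k"] exI[of _ "nat l"] conjI) simp_all
      then show ?thesis ..
    next
      case False
      then have "l < 0" using kl(2) by simp
      from block_gram_negative[OF T B assms(1,2) this] B
      have "block_gram d E \<epsilon> (2 * int d + 1) (- 2)" by simp
      from block_gram_imp_doubly_regular_deletion[OF T this \<open>d > 0\<close>] show ?thesis ..
    qed
  next
    assume "?del \<or> ?sim"
    then show "\<exists>\<epsilon> k l. k > 0 \<and> l \<noteq> 0 \<and> block_gram d E \<epsilon> k l"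
    proof
      assume ?del
      then obtain V F v where "doubly_regular (V :: nat set) F" "v \<in> V"
        "tournament_iso {..<2*d} E (V - {v}) (delete_vertex V F v)" by blast
      from doubly_regular_deletion_imp_block_gram[OF this(1,2) \<open>d > 0\<close> this(3)]
      obtain \<epsilon> where "block_gram d E \<epsilon> (2 * int d + 1) (- 2)" ..
      then show ?thesis by (intro exI[of _ \<epsilon>] exI[of _ "2 * int d + 1"] exI[of _ "- 2"]) simp
    next
      assume ?sim
      then obtain k l :: nat where kl: "k > 0" "l > 0"
        and P: "perm_similar (2*d) (seidel_mat (2*d) E * seidel_mat (2*d) E)
          (let B = of_nat k \<cdot>\<^sub>m 1\<^sub>m d + of_nat l \<cdot>\<^sub>m all_ones_mat d
           in four_block_mat B (0\<^sub>m d d) (0\<^sub>m d d) B)" by blast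
      from perm_similar_imp_block_gram[OF T P] obtain \<epsilon> where "block_gram d E \<epsilon> (int k) (int l)" ..
      then show ?thesis using kl by (intro exI[of _ \<epsilon>] exI[of _ "int k"] exI[of _ "int l"]) simp
    qed
  qed
  finally show ?thesis .
qed

end
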